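(* The asymptotic growth constant for the number of dimer-monomers on the generalized two-dimensional Sierpinski gasket $SG_{2,4}(n)$, $$z_{SG_{2,4}}=\lim_{n\to\infty}\frac{\ln N_{DM}(SG_{2,4}(n))}{v(SG_{2,4}(n))},$$ is $z_{SG_{2,4}}=0.684872262332\ldots$ (i.e. its decimal expansion begins with the digits shown).
   Context: A dimer-monomer configuration on a finite graph $G$ is a placement of dimers on edges such that each vertex is covered by at most one dimer (i.e. a matching of $G$, not necessarily perfect, possibly empty). $N_{DM}(G)$ is the number of such configurations, and $v(G)$ is the number of vertices of $G$. For an integer $b\ge 2$ the generalized two-dimensional Sierpinski gasket graph $SG_{2,b}(n)$, with three distinguished "outmost" vertices labelled $1,2,3$, is defined recursively. $SG_{2,b}(0)$ is a triangle (three vertices, three edges), all of whose vertices are outmost. $SG_{2,b}(n+1)$ consists of $b$ layers of copies of $SG_{2,b}(n)$ arranged in a triangle of side $b$: take one disjoint copy $C_p$ of $SG_{2,b}(n)$ for each $p\in\mathbb{Z}_{\ge 0}^3$ with coordinate sum $b-1$ (so $b(b+1)/2$ copies), assign to the outmost vertex $l$ of $C_p$ the position $p+e_l$ ($e_1,e_2,e_3$ the standard basis vectors), and identify all outmost vertices of copies having the same position. The outmost vertex $l$ of $SG_{2,b}(n+1)$ is the vertex at position $b\,e_l$. For $b=4$ one has $v(SG_{2,4}(n))=(4\cdot 10^n+5)/3$. *)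

theory Defs
  imports Complex_Main "HOL-Library.Product_Plus"
begin

record 'a graph =
  verts :: "'a set"
  edges :: "'a set set"

definition dimer_monomer_configs :: "'a graph \<Rightarrow> 'a set set set" where
  "dimer_monomer_configs G =
     {M. M \<subseteq> edges G \<and> (\<forall>v\<in>verts G. \<forall>e\<in>M. \<forall>f\<in>M. v \<in> e \<longrightarrow> v \<in> f \<longrightarrow> e = f)}"

definition N_DM :: "'a graph \<Rightarrow> nat" where
  "N_DM G = card (dimer_monomer_configs G)"

definition num_verts :: "'a graph \<Rightarrow> nat" where
  "num_verts G = card (verts G)"

datatype corner = C1 | C2 | C3

type_synonym pos = "nat \<times> nat \<times> nat"

primrec axis :: "corner \<Rightarrow> nat \<Rightarrow> pos" where
  "axis C1 k = (k, 0, 0)"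
| "axis C2 k = (0, k, 0)"
| "axis C3 k = (0, 0, k)"

definition cells :: "nat \<Rightarrow> pos set" where
  "cells b = {(i, j, k). i + j + k + 1 = b}"

text \<open>
  Vertices of the glued graph are normal forms for the identification:
  \<open>Junction x\<close> is the class of all outmost vertices (of copies) at position \<open>x\<close>;
  \<open>Inner p v\<close> is a vertex \<open>v\<close> of copy \<open>p\<close> that is not outmost in that copy, so it is
  identified with nothing else. In the initial triangle, \<open>Junction (axis l 1)\<close> merely
  names the outmost vertex \<open>l\<close>.
\<close>
datatype vertex = Junction pos | Inner pos vertex

fun outmost :: "nat \<Rightarrow> nat \<Rightarrow> corner \<Rightarrow> vertex" where
  "outmost b 0 l = Junction (axis l 1)"
| "outmost b (Suc n) l = Junction (axis l b)"

text \<open>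
  The map from copy \<open>p\<close> of the stage-\<open>n\<close> graph into the quotient that is the
  stage-\<open>Suc n\<close> graph.
\<close>
definition glue :: "nat \<Rightarrow> nat \<Rightarrow> pos \<Rightarrow> vertex \<Rightarrow> vertex" where
  "glue b n p v =
     (if v = outmost b n C1 then Junction (p + axis C1 1)
      else if v = outmost b n C2 then Junction (p + axis C2 1)
      else if v = outmost b n C3 then Junction (p + axis C3 1)
      else Inner p v)"

text \<open>
  The graph \<open>SG\<^bsub>2,b\<^esub>(n)\<close>, meaningful for \<open>b \<ge> 2\<close>. Distinct copies share at most one
  vertex, so the identification creates no parallel edges and no loops, and representing
  edges as two-element vertex sets loses nothing.
\<close>
primrec SG :: "nat \<Rightarrow> nat \<Rightarrow> vertex graph" where
  "SG b 0 =
     \<lparr>verts = range (outmost b 0),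
      edges = {{outmost b 0 k, outmost b 0 l} | k l. k \<noteq> l}\<rparr>"
| "SG b (Suc n) =
     \<lparr>verts = (\<Union>p\<in>cells b. glue b n p ` verts (SG b n)),
      edges = (\<Union>p\<in>cells b. (\<lambda>e. glue b n p ` e) ` edges (SG b n))\<rparr>"

end

theory Submission
  imports "HOL-Library.Disjoint_Sets" "HOL-Analysis.Harmonic_Numbers" Defs
begin

text \<open>
  Let the weight of a set of outmost vertices be the number of matchings of the stage-n graph that
  cover exactly these outmost vertices; by symmetry it only depends on the size of the set. The ten
  copies of stage n in stage n + 1 form three corner blocks of three copies each, which share one
  interior junction each with the centre copy and one boundary junction with each other; contracting
  this network gives a map of the four weights that is homogeneous of degree 10 and monotone.
  Hence any direction v that the map sends between lam v and lam' v, and that is comparable to the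
  weights of stage m, encloses the growth constant; already m = 2 with the normalised weights
  rounded to twelve digits gives the required precision. The limit exists because restricting
  matchings to the copies shows that the matching number at stage n + 1 is at most the tenth power
  of that at stage n.
\<close>


section \<open>Matchings by covered junctions\<close>

text \<open>The recursion of the weights is nonlinear and no closed form of it is used, so the
  digits come from an enclosure with controlled error. Homogeneity provides the control: scaling the
  weights of stage m by a factor shifts their logarithms at stage m + j by 10^j times its logarithm,
  while the vertex number also grows tenfold per stage. An error at stage m thus enters the constant
  divided by 10^m, and the gap between lam and lam' is summed up by a geometric series with value
  1/9. Stage 2 suffices because its weights are, to about twelve digits, geometric in the number of
  covered vertices: the three corners are almost decoupled, and the ratio hardly changes afterwards.
  Two obstacles shape the rest. An interior junction belongs to three copies, so gluing two of them
  must not yet forget it; hence the gluing rule separates junctions that are summed out from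
  junctions that stay visible. And the map has to be evaluated at twelve-digit entries, giving
  values with more than 100 digits; contracting the ring of corner blocks as a trace of 2 x 2
  matrices makes this cheap.\<close>

definition matchings :: "'a set set \<Rightarrow> 'a set set set" where
  "matchings E = {M. M \<subseteq> E \<and> disjoint M}"

definition cover_count :: "'a set \<Rightarrow> 'a set set \<Rightarrow> 'a set \<Rightarrow> nat" where
  "cover_count J E U = card {M \<in> matchings E. \<Union>M \<inter> J = U}"

lemma finite_matchings: "finite E \<Longrightarrow> finite (matchings E)"
  unfolding matchings_def by (rule finite_subset[of _ "Pow E"]) auto

text \<open>\<open>disjoint\<close> compares only different members, so an edge lying in both
  \<open>M1\<close> and \<open>M2\<close> would go unnoticed on the left;
  \<open>E1 \<inter> E2 = {}\<close> excludes this.\<close>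

lemma matchings_Un_iff:
  assumes "M1 \<subseteq> E1" "M2 \<subseteq> E2" "E1 \<inter> E2 = {}"
  shows "M1 \<union> M2 \<in> matchings (E1 \<union> E2) \<longleftrightarrow>
           M1 \<in> matchings E1 \<and> M2 \<in> matchings E2 \<and> \<Union>M1 \<inter> \<Union>M2 = {}"
proof -
  have "disjoint (M1 \<union> M2) \<longleftrightarrow> disjoint M1 \<and> disjoint M2 \<and> \<Union>M1 \<inter> \<Union>M2 = {}"
    (is "?L \<longleftrightarrow> ?R")
  proof
    assume L: ?L
    have "e \<inter> f = {}" if "e \<in> M1" "f \<in> M2" for e f
      using L that assms unfolding disjoint_def by (metis IntI UnCI empty_iff subsetD)
    then show ?R using L unfolding disjoint_def by blast
  next
    assume R: ?R
    have "e \<inter> f = {}" if "e \<in> M1" "f \<in> M2" for e f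
      using R that by blast
    then show ?L
      using R unfolding disjoint_def by (metis Int_commute UnE)
  qed
  then show ?thesis using assms unfolding matchings_def by auto
qed

text \<open>The gluing rule. \<open>J1\<close> and \<open>J2\<close> are the visible vertices of two
  pieces that touch only in \<open>S\<close>; \<open>A\<close> and \<open>B\<close> are the shared
  vertices covered from either side. Vertices in \<open>D\<close> become invisible, so any disjoint
  \<open>A\<close>, \<open>B\<close> may occur there; those in \<open>R\<close> remain visible, so
  \<open>U\<close> prescribes whether one of the two sides covers them.\<close>

lemma cover_count_Un:
  assumes fin: "finite E1" "finite E2" "finite S" and disj: "E1 \<inter> E2 = {}"
    and S: "J1 \<inter> J2 = S" "\<Union>E1 \<inter> \<Union>E2 \<subseteq> S" "J1 \<inter> \<Union>E2 \<subseteq> S" "J2 \<inter> \<Union>E1 \<subseteq> S"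
    and DR: "S = D \<union> R" "D \<inter> R = {}"
    and J: "J = (J1 \<union> J2) - D" and U: "U \<subseteq> J"
  shows "cover_count J (E1 \<union> E2) U =
    (\<Sum>A\<in>Pow S. \<Sum>B\<in>Pow S.
       if A \<inter> B = {} \<and> (\<forall>x\<in>R. x \<in> U \<longleftrightarrow> x \<in> A \<or> x \<in> B)
       then cover_count J1 E1 (U \<inter> J1 - S \<union> A) * cover_count J2 E2 (U \<inter> J2 - S \<union> B) else 0)"
proof -
  define I where "I = {(A, B). A \<subseteq> S \<and> B \<subseteq> S \<and> A \<inter> B = {} \<and> (\<forall>x\<in>R. x \<in> U \<longleftrightarrow> x \<in> A \<or> x \<in> B)}"
  define X1 where "X1 A = {M \<in> matchings E1. \<Union>M \<inter> J1 = U \<inter> J1 - S \<union> A}" for A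
  define X2 where "X2 B = {M \<in> matchings E2. \<Union>M \<inter> J2 = U \<inter> J2 - S \<union> B}" for B
  define X where "X = {M \<in> matchings (E1 \<union> E2). \<Union>M \<inter> J = U}"
  define Y where "Y = (SIGMA AB:I. X1 (fst AB) \<times> X2 (snd AB))"
  have finI: "finite I"
    by (rule finite_subset[of _ "Pow S \<times> Pow S"]) (use fin in \<open>auto simp: I_def\<close>)
  have finX: "finite (X1 A)" "finite (X2 A)" for A
    using finite_matchings[OF fin(1)] finite_matchings[OF fin(2)] by (simp_all add: X1_def X2_def)
  \<comment> \<open>The first component is determined by the second; it only records the index of
    the summand to which the split matching belongs.\<close>
  define g where "g M = ((\<Union>(M \<inter> E1) \<inter> S, \<Union>(M \<inter> E2) \<inter> S), (M \<inter> E1, M \<inter> E2))" for M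
  have bij: "bij_betw g X Y"
  proof (rule bij_betw_byWitness[where f' = "\<lambda>(AB, (M1, M2)). M1 \<union> M2"])
    show "\<forall>M\<in>X. (case g M of (AB, M1, M2) \<Rightarrow> M1 \<union> M2) = M"
      by (auto simp: g_def X_def matchings_def)
    show "\<forall>z\<in>Y. g (case z of (AB, M1, M2) \<Rightarrow> M1 \<union> M2) = z"
    proof
      fix z assume "z \<in> Y"
      then obtain A B M1 M2 where z: "z = ((A, B), (M1, M2))" "(A, B) \<in> I" "M1 \<in> X1 A" "M2 \<in> X2 B"
        unfolding Y_def by auto
      have M: "M1 \<subseteq> E1" "M2 \<subseteq> E2" "\<Union>M1 \<inter> J1 = U \<inter> J1 - S \<union> A" "\<Union>M2 \<inter> J2 = U \<inter> J2 - S \<union> B"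
        using z by (auto simp: X1_def X2_def matchings_def)
      have e: "(M1 \<union> M2) \<inter> E1 = M1" "(M1 \<union> M2) \<inter> E2 = M2"
        using M disj by auto
      have "A \<subseteq> S" "B \<subseteq> S" using z by (auto simp: I_def)
      then have "\<Union>M1 \<inter> S = A" "\<Union>M2 \<inter> S = B"
        using M(3,4) S(1) by blast+
      then show "g (case z of (AB, M1, M2) \<Rightarrow> M1 \<union> M2) = z"
        by (simp add: z(1) g_def e)
    qed
    show "g ` X \<subseteq> Y"
    proof
      fix z assume "z \<in> g ` X"
      then obtain M where M: "M \<in> X" "z = g M" by auto
      define M1 M2 where "M1 = M \<inter> E1" and "M2 = M \<inter> E2"
      have sub: "M1 \<subseteq> E1" "M2 \<subseteq> E2" "M = M1 \<union> M2"
        using M by (auto simp: M1_def M2_def X_def matchings_def)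
      have m: "M1 \<in> matchings E1" "M2 \<in> matchings E2" "\<Union>M1 \<inter> \<Union>M2 = {}"
        using matchings_Un_iff[OF sub(1,2) disj] M sub(3) by (auto simp: X_def)
      have cov: "(\<Union>M1 \<union> \<Union>M2) \<inter> J = U" using M sub(3) by (auto simp: X_def)
      have V: "\<Union>M1 \<subseteq> \<Union>E1" "\<Union>M2 \<subseteq> \<Union>E2" using sub by auto
      have RJ: "R \<subseteq> J" "R \<subseteq> S" "J1 - S \<subseteq> J" "J2 - S \<subseteq> J" "J \<subseteq> J1 \<union> J2"
        using S(1) DR J by auto
      have "\<forall>x\<in>R. x \<in> U \<longleftrightarrow> x \<in> \<Union>M1 \<inter> S \<or> x \<in> \<Union>M2 \<inter> S"
        using cov RJ(1,2) by blast
      then have i: "(\<Union>M1 \<inter> S, \<Union>M2 \<inter> S) \<in> I"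
        unfolding I_def using m(3) by simp blast
      have "x \<in> U \<longleftrightarrow> x \<in> \<Union>M1" if "x \<in> J1 - S" for x
      proof -
        have "x \<in> J" "x \<notin> \<Union>E2" using that RJ(3) S(3) by blast+
        then have "x \<notin> \<Union>M2" using V(2) by blast
        then show ?thesis using \<open>x \<in> J\<close> cov by blast
      qed
      then have "\<Union>M1 \<inter> J1 = U \<inter> J1 - S \<union> (\<Union>M1 \<inter> S)"
        using S(1) by blast
      moreover have "x \<in> U \<longleftrightarrow> x \<in> \<Union>M2" if "x \<in> J2 - S" for x
      proof -
        have "x \<in> J" "x \<notin> \<Union>E1" using that RJ(4) S(4) by blast+
        then have "x \<notin> \<Union>M1" using V(1) by blast
        then show ?thesis using \<open>x \<in> J\<close> cov by blast
      qed
      then have "\<Union>M2 \<inter> J2 = U \<inter> J2 - S \<union> (\<Union>M2 \<inter> S)"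
        using S(1) by blast
      ultimately show "z \<in> Y"
        using i m by (auto simp: Y_def M(2) g_def X1_def X2_def M1_def[symmetric] M2_def[symmetric])
    qed
    show "(\<lambda>(AB, M1, M2). M1 \<union> M2) ` Y \<subseteq> X"
    proof
      fix z assume "z \<in> (\<lambda>(AB, M1, M2). M1 \<union> M2) ` Y"
      then obtain A B M1 M2 where z: "z = M1 \<union> M2" "(A, B) \<in> I" "M1 \<in> X1 A" "M2 \<in> X2 B"
        unfolding Y_def by auto
      have M: "M1 \<in> matchings E1" "M2 \<in> matchings E2"
          "\<Union>M1 \<inter> J1 = U \<inter> J1 - S \<union> A" "\<Union>M2 \<inter> J2 = U \<inter> J2 - S \<union> B"
        using z by (auto simp: X1_def X2_def)
      have sub: "M1 \<subseteq> E1" "M2 \<subseteq> E2" using M by (auto simp: matchings_def)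
      have V: "\<Union>M1 \<subseteq> \<Union>E1" "\<Union>M2 \<subseteq> \<Union>E2" using sub by auto
      have AB: "A \<subseteq> S" "B \<subseteq> S" "A \<inter> B = {}" "\<forall>x\<in>R. x \<in> U \<longleftrightarrow> x \<in> A \<or> x \<in> B"
        using z by (auto simp: I_def)
      have t: "\<Union>M1 \<inter> S = A" "\<Union>M2 \<inter> S = B" using M AB S(1) by blast+
      have "\<Union>M1 \<inter> \<Union>M2 = {}" using t AB V S(2) by blast
      then have "z \<in> matchings (E1 \<union> E2)"
        using matchings_Un_iff[OF sub disj] M z(1) by blast
      moreover have "\<Union>z \<inter> J = U"
      proof (rule set_eqI)
        fix x
        have z': "x \<in> \<Union>z \<longleftrightarrow> x \<in> \<Union>M1 \<or> x \<in> \<Union>M2" using z(1) by simp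
        consider "x \<notin> J" | "x \<in> R" | "x \<in> J1" "x \<notin> S" "x \<in> J" | "x \<in> J2" "x \<notin> S" "x \<in> J"
          using S(1) DR J by blast
        then show "x \<in> \<Union>z \<inter> J \<longleftrightarrow> x \<in> U"
        proof cases
          case 1 then show ?thesis using U by blast
        next
          case 2
          then have "x \<in> J" "x \<in> S" using J S(1) DR by auto
          then have "x \<in> \<Union>M1 \<longleftrightarrow> x \<in> A" "x \<in> \<Union>M2 \<longleftrightarrow> x \<in> B" using t by blast+
          then show ?thesis using AB(4) 2 z' \<open>x \<in> J\<close> by simp
        next
          case 3
          then have "x \<notin> \<Union>M2" using S(3) V(2) by blast
          moreover have "x \<in> \<Union>M1 \<longleftrightarrow> x \<in> U" using M(3) AB(1) 3 by blast
          ultimately show ?thesis using z' 3 by simp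
        next
          case 4
          then have "x \<notin> \<Union>M1" using S(4) V(1) by blast
          moreover have "x \<in> \<Union>M2 \<longleftrightarrow> x \<in> U" using M(4) AB(2) 4 by blast
          ultimately show ?thesis using z' 4 by simp
        qed
      qed
      ultimately show "z \<in> X" by (simp add: X_def)
    qed
  qed
  have "cover_count J (E1 \<union> E2) U = card Y"
    using bij_betw_same_card[OF bij] by (simp add: cover_count_def X_def)
  also have "\<dots> = (\<Sum>AB\<in>I. card (X1 (fst AB)) * card (X2 (snd AB)))"
    unfolding Y_def using finI finX by (simp add: card_SigmaI card_cartesian_product)
  also have "\<dots> = (\<Sum>AB\<in>Pow S \<times> Pow S. if AB \<in> I then card (X1 (fst AB)) * card (X2 (snd AB)) else 0)"
    by (rule sum.mono_neutral_cong_left) (use fin in \<open>auto simp: I_def\<close>)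
  also have "\<dots> = (\<Sum>A\<in>Pow S. \<Sum>B\<in>Pow S. if (A, B) \<in> I then card (X1 A) * card (X2 B) else 0)"
    by (simp add: sum.cartesian_product case_prod_beta)
  also have "\<dots> = (\<Sum>A\<in>Pow S. \<Sum>B\<in>Pow S.
       if A \<inter> B = {} \<and> (\<forall>x\<in>R. x \<in> U \<longleftrightarrow> x \<in> A \<or> x \<in> B)
       then cover_count J1 E1 (U \<inter> J1 - S \<union> A) * cover_count J2 E2 (U \<inter> J2 - S \<union> B) else 0)"
    by (intro sum.cong refl) (auto simp: I_def X1_def X2_def cover_count_def)
  finally show ?thesis .
qed

text \<open>Invariance under relabelling, needed to carry the counts of one stage over to each of
  its copies inside the next stage.\<close>

lemma cover_count_image:
  assumes inj: "inj_on f (\<Union>E \<union> J)" and U: "U \<subseteq> J"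
  shows "cover_count (f ` J) ((`) f ` E) (f ` U) = cover_count J E U"
proof -
  have injP: "inj_on ((`) f) (Pow (\<Union>E \<union> J))"
    using inj by (rule inj_on_image_Pow)
  have injE: "inj_on ((`) f) E"
    by (rule inj_on_subset[OF injP]) auto
  have int: "f ` X \<inter> f ` Y = f ` (X \<inter> Y)" if "X \<subseteq> \<Union>E \<union> J" "Y \<subseteq> \<Union>E \<union> J" for X Y
    using inj_on_image_Int[OF inj that] by simp
  have disj: "disjoint ((`) f ` M) \<longleftrightarrow> disjoint M" if "M \<subseteq> E" for M
  proof -
    have s: "e \<subseteq> \<Union>E \<union> J" if "e \<in> M" for e using \<open>M \<subseteq> E\<close> that by auto
    have "f ` e = f ` e' \<longleftrightarrow> e = e'" if "e \<in> M" "e' \<in> M" for e e'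
      using injE that \<open>M \<subseteq> E\<close> by (meson inj_on_eq_iff subsetD)
    moreover have "f ` e \<inter> f ` e' = {} \<longleftrightarrow> e \<inter> e' = {}" if "e \<in> M" "e' \<in> M" for e e'
      using int[OF s s] that by simp
    ultimately show ?thesis unfolding disjoint_def by auto
  qed
  have cov: "\<Union>((`) f ` M) \<inter> f ` J = f ` U \<longleftrightarrow> \<Union>M \<inter> J = U" if "M \<subseteq> E" for M
  proof -
    have s: "\<Union>M \<subseteq> \<Union>E \<union> J" using that by auto
    have "\<Union>((`) f ` M) \<inter> f ` J = f ` (\<Union>M \<inter> J)"
      using int[OF s, of J] by (auto simp: image_Union)
    moreover have "f ` (\<Union>M \<inter> J) = f ` U \<longleftrightarrow> \<Union>M \<inter> J = U"
      by (rule inj_on_image_eq_iff[OF inj]) (use that U in auto)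
    ultimately show ?thesis by simp
  qed
  have "{M \<in> matchings ((`) f ` E). \<Union>M \<inter> f ` J = f ` U} =
        (`) ((`) f) ` {M \<in> matchings E. \<Union>M \<inter> J = U}" (is "?A = ?B")
  proof
    show "?A \<subseteq> ?B"
    proof
      fix N assume N: "N \<in> ?A"
      then obtain M where M: "M \<subseteq> E" "N = (`) f ` M"
        unfolding matchings_def by (auto elim: subset_imageE)
      then have "M \<in> matchings E \<and> \<Union>M \<inter> J = U"
        using N disj[OF M(1)] cov[OF M(1)] by (simp add: matchings_def)
      then show "N \<in> ?B" using M by blast
    qed
    show "?B \<subseteq> ?A"
    proof
      fix N assume "N \<in> ?B"
      then obtain M where "M \<in> matchings E" "\<Union>M \<inter> J = U" "N = (`) f ` M"
        by blast
      then show "N \<in> ?A"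
        using disj[of M] cov[of M] by (simp add: matchings_def image_mono)
    qed
  qed
  moreover have "inj_on ((`) ((`) f)) {M \<in> matchings E. \<Union>M \<inter> J = U}"
    by (rule inj_on_subset[OF inj_on_image_Pow[OF injE]]) (auto simp: matchings_def)
  ultimately show ?thesis
    unfolding cover_count_def by (simp add: card_image)
qed

lemma card_matchings_Union_le:
  assumes "finite P" "\<And>p. p \<in> P \<Longrightarrow> finite (E p)"
  shows "card (matchings (\<Union>p\<in>P. E p)) \<le> (\<Prod>p\<in>P. card (matchings (E p)))"
  using assms
proof (induction P rule: finite_induct)
  case empty
  have "matchings {} = {{}::'b set set}" by (auto simp: matchings_def disjoint_def)
  then show ?case by simp
next
  case (insert p P)
  let ?F = "\<Union>q\<in>P. E q"
  have fin: "finite (E p)" "finite ?F" using insert by auto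
  have "M = (M \<inter> E p) \<union> (M \<inter> ?F)" if "M \<in> matchings (E p \<union> ?F)" for M
    using that unfolding matchings_def by (simp only: mem_Collect_eq flip: Int_Un_distrib) (simp only: inf.absorb1)
  then have "inj_on (\<lambda>M. (M \<inter> E p, M \<inter> ?F)) (matchings (E p \<union> ?F))"
    by (intro inj_onI) (metis prod.inject)
  moreover have "(\<lambda>M. (M \<inter> E p, M \<inter> ?F)) ` matchings (E p \<union> ?F) \<subseteq> matchings (E p) \<times> matchings ?F"
    by (auto simp: matchings_def disjoint_def)
  ultimately have "card (matchings (E p \<union> ?F)) \<le> card (matchings (E p) \<times> matchings ?F)"
    using fin by (intro card_inj_on_le) (auto simp: finite_matchings)
  also have "\<dots> \<le> card (matchings (E p)) * (\<Prod>q\<in>P. card (matchings (E q)))"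
    using insert by (simp add: card_cartesian_product)
  finally show ?case using insert by simp
qed

section \<open>Contraction of the ten copies\<close>

text \<open>All that contraction has to know about the copies: different pieces have different edges
  and meet only in vertices that are junctions of both. \<open>jn_meet\<close> prevents a junction
  of one piece from being an inner vertex of another.\<close>

locale glued_family =
  fixes P :: "'p set" and jn :: "'p \<Rightarrow> 'v set" and E :: "'p \<Rightarrow> 'v set set"
  assumes finite_edges: "p \<in> P \<Longrightarrow> finite (E p)"
    and finite_jn: "p \<in> P \<Longrightarrow> finite (jn p)"
    and edges_disjoint: "p \<in> P \<Longrightarrow> q \<in> P \<Longrightarrow> p \<noteq> q \<Longrightarrow> E p \<inter> E q = {}"
    and meet: "p \<in> P \<Longrightarrow> q \<in> P \<Longrightarrow> p \<noteq> q \<Longrightarrow> \<Union>(E p) \<inter> \<Union>(E q) \<subseteq> jn p \<inter> jn q"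
    and jn_meet: "p \<in> P \<Longrightarrow> q \<in> P \<Longrightarrow> jn p \<inter> \<Union>(E q) \<subseteq> jn q"
begin

definition part :: "'p set \<Rightarrow> 'v set set" where
  "part Q = \<Union>(E ` Q)"

definition bd :: "'p set \<Rightarrow> 'v set" where
  "bd Q = \<Union>(jn ` Q)"

text \<open>\<open>bd\<close> also contains junctions that were summed out earlier, while
  \<open>J1\<close> and \<open>J2\<close> are the ones still visible. The condition
  \<open>bd Q1 \<inter> bd Q2 \<subseteq> J1 \<inter> J2\<close> says that nothing was forgotten
  that the two groups still have to share.\<close>

lemma cover_count_parts:
  assumes Q: "Q1 \<subseteq> P" "Q2 \<subseteq> P" "Q1 \<inter> Q2 = {}" "finite Q1" "finite Q2"
    and J12: "J1 \<subseteq> bd Q1" "J2 \<subseteq> bd Q2" "bd Q1 \<inter> bd Q2 \<subseteq> J1 \<inter> J2"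
    and DR: "J1 \<inter> J2 = D \<union> R" "D \<inter> R = {}"
    and J: "J = (J1 \<union> J2) - D" and U: "U \<subseteq> J"
  shows "cover_count J (part (Q1 \<union> Q2)) U =
    (\<Sum>A\<in>Pow (D \<union> R). \<Sum>B\<in>Pow (D \<union> R).
       if A \<inter> B = {} \<and> (\<forall>x\<in>R. x \<in> U \<longleftrightarrow> x \<in> A \<or> x \<in> B)
       then cover_count J1 (part Q1) (U \<inter> J1 - (D \<union> R) \<union> A) *
         cover_count J2 (part Q2) (U \<inter> J2 - (D \<union> R) \<union> B) else 0)"
proof -
  have "part (Q1 \<union> Q2) = part Q1 \<union> part Q2" by (simp add: part_def)
  moreover have "finite (part Q1)" "finite (part Q2)"
    using Q finite_edges by (auto simp: part_def)
  moreover have "finite (bd Q1)"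
    using Q finite_jn by (auto simp: bd_def)
  then have "finite (D \<union> R)"
    using J12(1) DR(1) by (metis finite_subset inf_le1)
  moreover have "part Q1 \<inter> part Q2 = {}"
    using Q edges_disjoint by (fastforce simp: part_def)
  moreover have "\<Union>(part Q1) \<inter> \<Union>(part Q2) \<subseteq> D \<union> R"
  proof
    fix x assume "x \<in> \<Union>(part Q1) \<inter> \<Union>(part Q2)"
    then obtain p q where "p \<in> Q1" "q \<in> Q2" "x \<in> \<Union>(E p)" "x \<in> \<Union>(E q)"
      by (auto simp: part_def)
    then have "x \<in> bd Q1 \<inter> bd Q2"
      using meet[of p q] Q by (fastforce simp: bd_def)
    then show "x \<in> D \<union> R" using J12 DR by blast
  qed
  moreover have "bd Q \<inter> \<Union>(part Q') \<subseteq> bd Q'" if "Q \<subseteq> P" "Q' \<subseteq> P" for Q Q'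
  proof
    fix x assume "x \<in> bd Q \<inter> \<Union>(part Q')"
    then obtain p q where "p \<in> Q" "q \<in> Q'" "x \<in> jn p" "x \<in> \<Union>(E q)"
      by (auto simp: bd_def part_def)
    then show "x \<in> bd Q'" using jn_meet[of p q] that by (fastforce simp: bd_def)
  qed
  then have bd_meet: "bd Q1 \<inter> \<Union>(part Q2) \<subseteq> bd Q2" "bd Q2 \<inter> \<Union>(part Q1) \<subseteq> bd Q1"
    using Q by blast+
  moreover have "J1 \<inter> \<Union>(part Q2) \<subseteq> D \<union> R" "J2 \<inter> \<Union>(part Q1) \<subseteq> D \<union> R"
    unfolding DR(1)[symmetric] using bd_meet J12 by blast+
  ultimately show ?thesis
    by (simp only:) (rule cover_count_Un[OF _ _ _ _ _ _ _ _ refl]; use DR J U in auto)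
qed

end

text \<open>As a rewrite rule this unrolls the gluing sums over explicit sets of junctions into
  finitely many states.\<close>

lemma sum_Pow_insert:
  assumes "finite S" "x \<notin> S"
  shows "(\<Sum>A\<in>Pow (insert x S). g A) = (\<Sum>A\<in>Pow S. g A) + (\<Sum>A\<in>Pow S. g (insert x A))"
proof -
  have "inj_on (insert x) (Pow S)" using assms by (auto simp: inj_on_def)
  moreover have "Pow S \<inter> insert x ` Pow S = {}" using assms by auto
  ultimately show ?thesis
    using assms by (simp add: Pow_insert sum.union_disjoint sum.reindex)
qed

text \<open>
  The two arguments tell whether a junction is covered from its one and from its other side; matchings
  exclude that both hold. In \<open>share\<close> the junction is summed out, in \<open>joint i\<close> it stays
  visible and \<open>i\<close> tells whether it is covered.
\<close>
definition share :: "(bool \<Rightarrow> bool \<Rightarrow> 'a::comm_semiring_1) \<Rightarrow> 'a" where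
  "share g = g False False + g True False + g False True"

definition joint :: "bool \<Rightarrow> (bool \<Rightarrow> bool \<Rightarrow> 'a::comm_semiring_1) \<Rightarrow> 'a" where
  "joint i g = (if i then g True False + g False True else g False False)"

definition tri :: "(nat \<Rightarrow> 'a::comm_semiring_1) \<Rightarrow> bool \<Rightarrow> bool \<Rightarrow> bool \<Rightarrow> 'a" where
  "tri w a b c = w (of_bool a + of_bool b + of_bool c)"

text \<open>
  Three copies in a corner: \<open>x\<close> is the outmost vertex, \<open>i\<close> the interior junction (shared with
  the centre copy), \<open>m\<close> and \<open>n\<close> are the junctions in the middle of two sides. In \<open>whole\<close>,
  \<open>c1\<close>, \<open>c2\<close>, \<open>c3\<close> refer to the centre copy, and \<open>m12\<close>, \<open>m21\<close> to the two sides
  of the junction between the blocks at 1 and 2.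
\<close>
definition block :: "(nat \<Rightarrow> 'a::comm_semiring_1) \<Rightarrow> bool \<Rightarrow> bool \<Rightarrow> bool \<Rightarrow> bool \<Rightarrow> 'a" where
  "block w x i m n = share (\<lambda>b b'. joint i (\<lambda>y z.
     share (\<lambda>a a'. tri w x a b * tri w a' y m) * tri w b' z n))"

definition whole :: "(nat \<Rightarrow> 'a::comm_semiring_1) \<Rightarrow> bool \<Rightarrow> bool \<Rightarrow> bool \<Rightarrow> 'a" where
  "whole w x1 x2 x3 =
     share (\<lambda>c3 i3. share (\<lambda>m13 m31. share (\<lambda>m23 m32.
       share (\<lambda>c2 i2. share (\<lambda>m12 m21.
         share (\<lambda>c1 i1. tri w c1 c2 c3 * block w x1 i1 m12 m13)
         * block w x2 i2 m21 m23))
       * block w x3 i3 m31 m32)))"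

context glued_family begin

context
  fixes w
  assumes cell: "\<And>p a b c U. p \<in> P \<Longrightarrow> jn p = {a, b, c} \<Longrightarrow> distinct [a, b, c] \<Longrightarrow> U \<subseteq> jn p \<Longrightarrow>
    cover_count (jn p) (E p) U = tri w (a \<in> U) (b \<in> U) (c \<in> U)"
begin

text \<open>The copy \<open>p\<close> sits at the corner; \<open>q\<close> and \<open>r\<close> hang
  on it at \<open>a\<close> and \<open>b\<close> and meet each other in \<open>i\<close>. Gluing
  proceeds from \<open>p\<close> to \<open>q\<close> and then to \<open>r\<close>.\<close>

lemma cover_count_block:
  assumes P: "p \<in> P" "q \<in> P" "r \<in> P" "distinct [p, q, r]"
    and jn: "jn p = {x, a, b}" "jn q = {a, i, m}" "jn r = {b, i, n}"
    and dist: "distinct [x, a, b, i, m, n]" and U: "U \<subseteq> {x, i, m, n}"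
  shows "cover_count {x, i, m, n} (part {p, q, r}) U = block w (x \<in> U) (i \<in> U) (m \<in> U) (n \<in> U)"
proof -
  have ne: "p \<noteq> q" "p \<noteq> r" "q \<noteq> r" using P by auto
  have d: "x \<noteq> a" "x \<noteq> b" "x \<noteq> i" "x \<noteq> m" "x \<noteq> n" "a \<noteq> b" "a \<noteq> i" "a \<noteq> m" "a \<noteq> n" "b \<noteq> i" "b \<noteq> m" "b \<noteq> n"
     "i \<noteq> m" "i \<noteq> n" "m \<noteq> n" using dist by auto
  note d' = d d[symmetric]
  have p: "cover_count {x, a, b} (part {p}) U = tri w (x \<in> U) (a \<in> U) (b \<in> U)" if "U \<subseteq> {x, a, b}" for U
    using cell[OF P(1) jn(1), of U] that d' by (simp add: part_def jn)
  have q: "cover_count {a, i, m} (part {q}) U = tri w (a \<in> U) (i \<in> U) (m \<in> U)" if "U \<subseteq> {a, i, m}" for U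
    using cell[OF P(2) jn(2), of U] that d' by (simp add: part_def jn)
  have r: "cover_count {b, i, n} (part {r}) U = tri w (b \<in> U) (i \<in> U) (n \<in> U)" if "U \<subseteq> {b, i, n}" for U
    using cell[OF P(3) jn(3), of U] that d' by (simp add: part_def jn)
  have pq: "cover_count {x, b, i, m} (part ({p} \<union> {q})) U =
      share (\<lambda>a a'. tri w (x \<in> U) a (b \<in> U) * tri w a' (i \<in> U) (m \<in> U))"
    if "U \<subseteq> {x, b, i, m}" for U
  proof -
    have "cover_count {x, b, i, m} (part ({p} \<union> {q})) U = (\<Sum>A\<in>Pow ({a} \<union> {}). \<Sum>B\<in>Pow ({a} \<union> {}).
       if A \<inter> B = {} \<and> (\<forall>x\<in>{}. x \<in> U \<longleftrightarrow> x \<in> A \<or> x \<in> B)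
       then cover_count {x, a, b} (part {p}) (U \<inter> {x, a, b} - ({a} \<union> {}) \<union> A) *
         cover_count {a, i, m} (part {q}) (U \<inter> {a, i, m} - ({a} \<union> {}) \<union> B) else 0)"
      by (rule cover_count_parts) (use P ne jn d' that in \<open>auto simp: bd_def\<close>)
    also have "\<dots> = share (\<lambda>a a'. tri w (x \<in> U) a (b \<in> U) * tri w a' (i \<in> U) (m \<in> U))"
      using d' by (simp add: sum_Pow_insert p q share_def Diff_subset_conv le_infI2 cong: if_cong)
    finally show ?thesis .
  qed
  define G where "G x' b' i' m' = share (\<lambda>a a'. tri w x' a b' * tri w a' i' m')" for x' b' i' m'
  note pq = pq[folded G_def]
  \<comment> \<open>The only use of a nonempty \<open>R\<close>: \<open>i\<close> stays visible
    because the centre copy is attached to it later, whereas \<open>b\<close> is finished.\<close>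
  have "cover_count {x, i, m, n} (part (({p} \<union> {q}) \<union> {r})) U = (\<Sum>A\<in>Pow ({b} \<union> {i}). \<Sum>B\<in>Pow ({b} \<union> {i}).
     if A \<inter> B = {} \<and> (\<forall>x\<in>{i}. x \<in> U \<longleftrightarrow> x \<in> A \<or> x \<in> B)
     then cover_count {x, b, i, m} (part ({p} \<union> {q})) (U \<inter> {x, b, i, m} - ({b} \<union> {i}) \<union> A) *
       cover_count {b, i, n} (part {r}) (U \<inter> {b, i, n} - ({b} \<union> {i}) \<union> B) else 0)"
    by (rule cover_count_parts) (use P ne jn d' U in \<open>auto simp: bd_def\<close>)
  also have "\<dots> = share (\<lambda>b b'. joint (i \<in> U) (\<lambda>y z. G (x \<in> U) b y (m \<in> U) * tri w b' z (n \<in> U)))"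
    using d' by (simp add: sum_Pow_insert pq[simplified] r share_def joint_def Diff_subset_conv le_infI2 cong: if_cong)
  finally show ?thesis by (simp add: block_def G_def insert_commute)
qed

text \<open>The blocks are attached to the centre one after the other, along one, two and three
  junctions. Every shared junction is summed out at once, so that never more than five junctions are
  visible and each gluing sum stays small.\<close>

lemma cover_count_whole:
  assumes P: "c \<in> P" "Q1 \<subseteq> P" "Q2 \<subseteq> P" "Q3 \<subseteq> P" "finite Q1" "finite Q2" "finite Q3"
      "c \<notin> Q1 \<union> Q2 \<union> Q3" "Q1 \<inter> Q2 = {}" "Q1 \<inter> Q3 = {}" "Q2 \<inter> Q3 = {}"
    and jn: "jn c = {i1, i2, i3}"
    and bd: "{x1, i1, m12, m13} \<subseteq> bd Q1" "{x2, i2, m12, m23} \<subseteq> bd Q2" "{x3, i3, m13, m23} \<subseteq> bd Q3"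
    and meets: "jn c \<inter> bd Q1 = {i1}" "jn c \<inter> bd Q2 = {i2}" "jn c \<inter> bd Q3 = {i3}"
      "bd Q1 \<inter> bd Q2 = {m12}" "bd Q1 \<inter> bd Q3 = {m13}" "bd Q2 \<inter> bd Q3 = {m23}"
    and dist: "distinct [x1, x2, x3, i1, i2, i3, m12, m13, m23]"
    and block1: "\<And>U. U \<subseteq> {x1, i1, m12, m13} \<Longrightarrow>
      cover_count {x1, i1, m12, m13} (part Q1) U = block w (x1 \<in> U) (i1 \<in> U) (m12 \<in> U) (m13 \<in> U)"
    and block2: "\<And>U. U \<subseteq> {x2, i2, m12, m23} \<Longrightarrow>
      cover_count {x2, i2, m12, m23} (part Q2) U = block w (x2 \<in> U) (i2 \<in> U) (m12 \<in> U) (m23 \<in> U)"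
    and block3: "\<And>U. U \<subseteq> {x3, i3, m13, m23} \<Longrightarrow>
      cover_count {x3, i3, m13, m23} (part Q3) U = block w (x3 \<in> U) (i3 \<in> U) (m13 \<in> U) (m23 \<in> U)"
    and U: "U \<subseteq> {x1, x2, x3}"
  shows "cover_count {x1, x2, x3} (part (insert c (Q1 \<union> Q2 \<union> Q3))) U
    = whole w (x1 \<in> U) (x2 \<in> U) (x3 \<in> U)"
proof -
  have d: "x1 \<noteq> x2" "x1 \<noteq> x3" "x1 \<noteq> i1" "x1 \<noteq> i2" "x1 \<noteq> i3" "x1 \<noteq> m12" "x1 \<noteq> m13" "x1 \<noteq> m23"
    "x2 \<noteq> x3" "x2 \<noteq> i1" "x2 \<noteq> i2" "x2 \<noteq> i3" "x2 \<noteq> m12" "x2 \<noteq> m13" "x2 \<noteq> m23"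
    "x3 \<noteq> i1" "x3 \<noteq> i2" "x3 \<noteq> i3" "x3 \<noteq> m12" "x3 \<noteq> m13" "x3 \<noteq> m23"
    "i1 \<noteq> i2" "i1 \<noteq> i3" "i1 \<noteq> m12" "i1 \<noteq> m13" "i1 \<noteq> m23"
    "i2 \<noteq> i3" "i2 \<noteq> m12" "i2 \<noteq> m13" "i2 \<noteq> m23" "i3 \<noteq> m12" "i3 \<noteq> m13" "i3 \<noteq> m23"
    "m12 \<noteq> m13" "m12 \<noteq> m23" "m13 \<noteq> m23"
    using dist by auto
  note d' = d d[symmetric]
  have bdU: "bd (A \<union> B) = bd A \<union> bd B" "bd {c} = jn c" for A B
    by (auto simp: bd_def)
  have bdI: "bd (insert c A) = jn c \<union> bd A" for A
    by (auto simp: bd_def)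
  have centre: "cover_count {i1, i2, i3} (part {c}) U = tri w (i1 \<in> U) (i2 \<in> U) (i3 \<in> U)"
    if "U \<subseteq> {i1, i2, i3}" for U
    using cell[OF P(1) jn, of U] that d' by (simp add: part_def jn)

  define G1 where "G1 c2 c3 y m n = share (\<lambda>c1 i. tri w c1 c2 c3 * block w y i m n)" for c2 c3 y m n
  have G1: "cover_count {i2, i3, x1, m12, m13} (part ({c} \<union> Q1)) U =
      G1 (i2 \<in> U) (i3 \<in> U) (x1 \<in> U) (m12 \<in> U) (m13 \<in> U)"
    if "U \<subseteq> {i2, i3, x1, m12, m13}" for U
  proof -
    have "cover_count {i2, i3, x1, m12, m13} (part ({c} \<union> Q1)) U =
      (\<Sum>A\<in>Pow ({i1} \<union> {}). \<Sum>B\<in>Pow ({i1} \<union> {}).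
       if A \<inter> B = {} \<and> (\<forall>x\<in>{}. x \<in> U \<longleftrightarrow> x \<in> A \<or> x \<in> B)
       then cover_count {i1, i2, i3} (part {c}) (U \<inter> {i1, i2, i3} - ({i1} \<union> {}) \<union> A) *
         cover_count {x1, i1, m12, m13} (part Q1) (U \<inter> {x1, i1, m12, m13} - ({i1} \<union> {}) \<union> B) else 0)"
    proof (rule cover_count_parts)
      show "{i1, i2, i3} \<inter> {x1, i1, m12, m13} = {i1} \<union> {}" using d' by simp
      show "bd {c} \<inter> bd Q1 \<subseteq> {i1, i2, i3} \<inter> {x1, i1, m12, m13}" using meets by (simp add: bdU)
      show "{i2, i3, x1, m12, m13} = {i1, i2, i3} \<union> {x1, i1, m12, m13} - {i1}" using d' by auto
    qed (use P bd that in \<open>auto simp: bdU bdI jn\<close>)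
    also have "\<dots> = G1 (i2 \<in> U) (i3 \<in> U) (x1 \<in> U) (m12 \<in> U) (m13 \<in> U)"
      using d' by (simp add: sum_Pow_insert centre block1 G1_def share_def Diff_subset_conv le_infI2 cong: if_cong)
    finally show ?thesis .
  qed

  define G2 where "G2 c3 y n y' n' = share (\<lambda>c2 i. share (\<lambda>m m'. G1 c2 c3 y m n * block w y' i m' n'))" for c3 y n y' n'
  have G2: "cover_count {i3, x1, m13, x2, m23} (part (({c} \<union> Q1) \<union> Q2)) U =
      G2 (i3 \<in> U) (x1 \<in> U) (m13 \<in> U) (x2 \<in> U) (m23 \<in> U)"
    if "U \<subseteq> {i3, x1, m13, x2, m23}" for U
  proof -
    have "cover_count {i3, x1, m13, x2, m23} (part (({c} \<union> Q1) \<union> Q2)) U =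
      (\<Sum>A\<in>Pow ({i2, m12} \<union> {}). \<Sum>B\<in>Pow ({i2, m12} \<union> {}).
       if A \<inter> B = {} \<and> (\<forall>x\<in>{}. x \<in> U \<longleftrightarrow> x \<in> A \<or> x \<in> B)
       then cover_count {i2, i3, x1, m12, m13} (part ({c} \<union> Q1)) (U \<inter> {i2, i3, x1, m12, m13} - ({i2, m12} \<union> {}) \<union> A) *
         cover_count {x2, i2, m12, m23} (part Q2) (U \<inter> {x2, i2, m12, m23} - ({i2, m12} \<union> {}) \<union> B) else 0)"
    proof (rule cover_count_parts)
      show "{i2, i3, x1, m12, m13} \<inter> {x2, i2, m12, m23} = {i2, m12} \<union> {}" using d' by simp
      show "bd ({c} \<union> Q1) \<inter> bd Q2 \<subseteq> {i2, i3, x1, m12, m13} \<inter> {x2, i2, m12, m23}"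
        unfolding bdU Int_Un_distrib2 meets by auto
      show "{i3, x1, m13, x2, m23} = {i2, i3, x1, m12, m13} \<union> {x2, i2, m12, m23} - {i2, m12}" using d' by auto
    qed (use P bd that in \<open>auto simp: bdU bdI jn\<close>)
    also have "\<dots> = G2 (i3 \<in> U) (x1 \<in> U) (m13 \<in> U) (x2 \<in> U) (m23 \<in> U)"
      using d' by (simp add: sum_Pow_insert G1[simplified] block2 G2_def share_def Diff_subset_conv le_infI2 cong: if_cong)
    finally show ?thesis .
  qed

  have "cover_count {x1, x2, x3} (part ((({c} \<union> Q1) \<union> Q2) \<union> Q3)) U =
      (\<Sum>A\<in>Pow ({i3, m13, m23} \<union> {}). \<Sum>B\<in>Pow ({i3, m13, m23} \<union> {}).
       if A \<inter> B = {} \<and> (\<forall>x\<in>{}. x \<in> U \<longleftrightarrow> x \<in> A \<or> x \<in> B)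
       then cover_count {i3, x1, m13, x2, m23} (part (({c} \<union> Q1) \<union> Q2)) (U \<inter> {i3, x1, m13, x2, m23} - ({i3, m13, m23} \<union> {}) \<union> A) *
         cover_count {x3, i3, m13, m23} (part Q3) (U \<inter> {x3, i3, m13, m23} - ({i3, m13, m23} \<union> {}) \<union> B) else 0)"
  proof (rule cover_count_parts)
    show "{i3, x1, m13, x2, m23} \<inter> {x3, i3, m13, m23} = {i3, m13, m23} \<union> {}" using d' by auto
    show "bd (({c} \<union> Q1) \<union> Q2) \<inter> bd Q3 \<subseteq> {i3, x1, m13, x2, m23} \<inter> {x3, i3, m13, m23}"
      unfolding bdU Int_Un_distrib2 meets by auto
    show "{x1, x2, x3} = {i3, x1, m13, x2, m23} \<union> {x3, i3, m13, m23} - {i3, m13, m23}" using d' by auto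
  qed (use P bd U in \<open>auto simp: bdU bdI jn\<close>)
  also have "\<dots> = share (\<lambda>c3 i3. share (\<lambda>m13 m31. share (\<lambda>m23 m32.
       G2 c3 (x1 \<in> U) m13 (x2 \<in> U) m23 * block w (x3 \<in> U) i3 m31 m32)))"
    using d' by (simp add: sum_Pow_insert G2[simplified] block3 share_def Diff_subset_conv le_infI2 cong: if_cong)
  finally show ?thesis by (simp add: whole_def G1_def G2_def Un_assoc)
qed

end

end

section \<open>Symmetry of the network under permutations of the corners\<close>

lemma block_swap: "block w x i m n = block w x i n m"
  by (simp add: block_def share_def joint_def tri_def algebra_simps)

lemma share_cong: "(\<And>a b. f a b = g a b) \<Longrightarrow> share f = share g"
  by (simp add: share_def)

lemma share_commute: "share (\<lambda>a b. share (\<lambda>c d. f a b c d)) = share (\<lambda>c d. share (\<lambda>a b. f a b c d))"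
  by (simp add: share_def add_ac)

lemma share_flip: "share f = share (\<lambda>a b. f b a)"
  by (simp add: share_def add_ac)

lemma share_mult: "share f * c = share (\<lambda>a b. f a b * c)" "c * share f = share (\<lambda>a b. c * f a b)"
  by (simp_all add: share_def algebra_simps)

text \<open>The order of gluing hides the symmetry of the network. With all six sums moved to the
  front, a permutation of the corners is just a reordering of sums and factors. The chain in the
  proof sorts the sums by adjacent exchanges.\<close>

lemma whole_flat: "whole w x1 x2 x3 =
  share (\<lambda>c1 i1. share (\<lambda>c2 i2. share (\<lambda>c3 i3.
    share (\<lambda>m12 m21. share (\<lambda>m13 m31. share (\<lambda>m23 m32.
      tri w c1 c2 c3 * block w x1 i1 m12 m13 * block w x2 i2 m21 m23 * block w x3 i3 m31 m32))))))"
  (is "_ = share (\<lambda>c1 i1. share (\<lambda>c2 i2. share (\<lambda>c3 i3.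
    share (\<lambda>m12 m21. share (\<lambda>m13 m31. share (\<lambda>m23 m32. ?F c1 i1 c2 i2 c3 i3 m12 m21 m13 m31 m23 m32))))))")
proof -
  have "whole w x1 x2 x3 = share (\<lambda>c3 i3. share (\<lambda>m13 m31. share (\<lambda>m23 m32.
       share (\<lambda>c2 i2. share (\<lambda>m12 m21. share (\<lambda>c1 i1. ?F c1 i1 c2 i2 c3 i3 m12 m21 m13 m31 m23 m32))))))"
    unfolding whole_def share_mult ..
  also have "\<dots> = share (\<lambda>c3 i3. share (\<lambda>m13 m31. share (\<lambda>c2 i2.
       share (\<lambda>m12 m21. share (\<lambda>c1 i1. share (\<lambda>m23 m32. ?F c1 i1 c2 i2 c3 i3 m12 m21 m13 m31 m23 m32))))))"
    by (rule share_cong, rule share_cong, rule trans[OF share_commute], rule share_cong, rule trans[OF share_commute], rule share_cong, rule share_commute)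
  also have "\<dots> = share (\<lambda>c3 i3. share (\<lambda>c2 i2.
       share (\<lambda>m12 m21. share (\<lambda>c1 i1. share (\<lambda>m13 m31. share (\<lambda>m23 m32. ?F c1 i1 c2 i2 c3 i3 m12 m21 m13 m31 m23 m32))))))"
    by (rule share_cong, rule trans[OF share_commute], rule share_cong, rule trans[OF share_commute], rule share_cong, rule share_commute)
  also have "\<dots> = share (\<lambda>c2 i2. share (\<lambda>c3 i3.
       share (\<lambda>c1 i1. share (\<lambda>m12 m21. share (\<lambda>m13 m31. share (\<lambda>m23 m32. ?F c1 i1 c2 i2 c3 i3 m12 m21 m13 m31 m23 m32))))))"
    by (rule trans[OF share_commute], rule share_cong, rule share_cong, rule share_commute)
  also have "\<dots> = share (\<lambda>c2 i2. share (\<lambda>c1 i1.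
       share (\<lambda>c3 i3. share (\<lambda>m12 m21. share (\<lambda>m13 m31. share (\<lambda>m23 m32. ?F c1 i1 c2 i2 c3 i3 m12 m21 m13 m31 m23 m32))))))"
    by (rule share_cong, rule share_commute)
  also have "\<dots> = share (\<lambda>c1 i1. share (\<lambda>c2 i2.
       share (\<lambda>c3 i3. share (\<lambda>m12 m21. share (\<lambda>m13 m31. share (\<lambda>m23 m32. ?F c1 i1 c2 i2 c3 i3 m12 m21 m13 m31 m23 m32))))))"
    by (rule share_commute)
  finally show ?thesis .
qed

lemma tri_swap: "tri w a b c = tri w b a c" "tri w a b c = tri w a c b"
  by (simp_all add: tri_def add_ac)

text \<open>Exchanging corners 1 and 2 swaps their junctions with the centre, flips the two sides of
  the junction between them, exchanges the side junctions towards corner 3, and reflects block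
  3.\<close>

lemma whole_swap12: "whole w x1 x2 x3 = whole w x2 x1 x3"
  unfolding whole_flat
  by (rule trans[OF share_commute], rule share_cong, rule share_cong, rule share_cong,
      rule trans[OF share_flip], rule share_cong, rule trans[OF share_commute], rule share_cong, rule share_cong,
      simp only: tri_swap(1)[of w _ _ _] block_swap[of w x3] mult_ac)

lemma whole_swap23: "whole w x1 x2 x3 = whole w x1 x3 x2"
  unfolding whole_flat
  by (rule share_cong, rule trans[OF share_commute], rule share_cong, rule share_cong, rule trans[OF share_commute], rule share_cong, rule share_cong,
      rule trans[OF share_flip], rule share_cong,
      simp only: tri_swap(2)[of w _ _ _] block_swap[of w x1] mult_ac)

text \<open>The two transpositions generate all permutations of the corners, so it suffices to
  evaluate with the first k corners covered. This reduces eight weights to four.\<close>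

lemma whole_count:
  "whole w x1 x2 x3 = (let k = of_bool x1 + of_bool x2 + of_bool x3 :: nat in
     whole w (1 \<le> k) (2 \<le> k) (3 \<le> k))"
  using whole_swap12[of w True False False] whole_swap23[of w False True False]
    whole_swap23[of w True False True] whole_swap12[of w False True True]
  by (cases x1; cases x2; cases x3) simp_all

section \<open>The graphs as glued copies\<close>

lemma UNIV_corner: "(UNIV :: corner set) = {C1, C2, C3}"
  using corner.exhaust by auto

lemma outmost_eq_iff: "b \<ge> 1 \<Longrightarrow> outmost b n k = outmost b n l \<longleftrightarrow> k = l"
  by (cases n; cases k; cases l) auto

lemma axis_eq_iff: "c \<ge> 1 \<Longrightarrow> axis k c = axis l c \<longleftrightarrow> k = l"
  by (cases k; cases l) auto

lemma glue_outmost: "b \<ge> 1 \<Longrightarrow> glue b n p (outmost b n l) = Junction (p + axis l 1)"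
  by (cases l) (simp_all add: glue_def outmost_eq_iff)

lemma glue_inner: "v \<notin> range (outmost b n) \<Longrightarrow> glue b n p v = Inner p v"
  by (auto simp: glue_def UNIV_corner)

lemma inj_glue:
  assumes "b \<ge> 1"
  shows "inj (glue b n p)"
proof (rule injI)
  fix u v assume eq: "glue b n p u = glue b n p v"
  show "u = v"
  proof (cases "u \<in> range (outmost b n)"; cases "v \<in> range (outmost b n)")
    assume "u \<in> range (outmost b n)" "v \<in> range (outmost b n)"
    then show ?thesis using eq assms by (auto simp: glue_outmost axis_eq_iff)
  qed (use eq assms in \<open>auto simp: glue_outmost glue_inner\<close>)
qed

lemma glue_eq_glue:
  assumes "b \<ge> 1" "p \<noteq> q" "glue b n p u = glue b n q v"
  obtains k l where "u = outmost b n k" "v = outmost b n l" "p + axis k 1 = q + axis l 1"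
proof -
  have "u \<in> range (outmost b n) \<and> v \<in> range (outmost b n)"
    using assms by (cases "u \<in> range (outmost b n)"; cases "v \<in> range (outmost b n)")
      (auto simp: glue_outmost glue_inner)
  then show ?thesis using that assms by (auto simp: glue_outmost)
qed

text \<open>One joint induction, since the parts are needed together. That edges have two vertices
  is used to see that different copies have no edge in common.\<close>

lemma SG_wf:
  assumes "b \<ge> 1"
  shows "finite (verts (SG b n)) \<and> finite (edges (SG b n)) \<and> \<Union>(edges (SG b n)) \<subseteq> verts (SG b n)
    \<and> (\<forall>e\<in>edges (SG b n). card e = 2) \<and> range (outmost b n) \<subseteq> verts (SG b n)"
proof (induction n)
  case 0
  have "finite (range (outmost b 0))" by (simp add: UNIV_corner)
  moreover have "edges (SG b 0) \<subseteq> Pow (range (outmost b 0))" by auto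
  moreover have "\<forall>e\<in>edges (SG b 0). card e = 2"
    using assms by (auto simp: axis_eq_iff card_insert_if)
  ultimately show ?case
    by (auto intro: finite_subset)
next
  case (Suc n)
  have fin: "finite (cells b)"
    by (rule finite_subset[of _ "{..b} \<times> {..b} \<times> {..b}"]) (auto simp: cells_def)
  have "card (glue b n p ` e) = 2" if "e \<in> edges (SG b n)" for e p
    using Suc that inj_glue[OF assms] by (metis card_image inj_on_subset subset_UNIV)
  moreover have "outmost b (Suc n) l \<in> verts (SG b (Suc n))" for l
  proof -
    have "axis l (b - 1) \<in> cells b" using assms by (cases l) (auto simp: cells_def)
    moreover have "outmost b (Suc n) l = glue b n (axis l (b - 1)) (outmost b n l)"
      using assms by (cases l) (simp_all add: glue_outmost)
    moreover have "outmost b n l \<in> verts (SG b n)" using Suc by blast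
    ultimately show ?thesis unfolding SG.simps graph.simps by blast
  qed
  ultimately show ?case using Suc fin by (auto simp del: outmost.simps) blast
qed

definition junctions :: "pos \<Rightarrow> vertex set" where
  "junctions p = range (\<lambda>l. Junction (p + axis l 1))"

lemma junctions_eq: "junctions (i, j, k) =
    {Junction (i + 1, j, k), Junction (i, j + 1, k), Junction (i, j, k + 1)}"
  by (auto simp: junctions_def UNIV_corner)

lemma junctions_eq_image: "b \<ge> 1 \<Longrightarrow> junctions p = glue b n p ` range (outmost b n)"
  by (auto simp: junctions_def glue_outmost image_iff)

text \<open>A common position p + e_k = q + e_l gives p - q = e_l - e_k, and for p different from q
  this difference determines both k and l.\<close>

lemma card_junctions_meet:
  assumes "p \<noteq> q" "x \<in> junctions p" "x \<in> junctions q" "y \<in> junctions p" "y \<in> junctions q"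
  shows "x = y"
  using assms by (cases p rule: prod_cases3; cases q rule: prod_cases3) (auto simp: junctions_eq)

definition copy_edges :: "nat \<Rightarrow> nat \<Rightarrow> pos \<Rightarrow> vertex set set" where
  "copy_edges b n p = (\<lambda>e. glue b n p ` e) ` edges (SG b n)"

text \<open>Taking every position as an index, not only those in \<open>cells b\<close>, avoids
  carrying membership conditions through the contraction.\<close>

lemma glued_family_SG:
  assumes b: "b \<ge> 1"
  shows "glued_family UNIV junctions (copy_edges b n)"
proof
  have meet: "\<Union>(copy_edges b n p) \<inter> \<Union>(copy_edges b n q) \<subseteq> junctions p \<inter> junctions q"
    if pq: "p \<noteq> q" for p q
  proof
    fix x assume "x \<in> \<Union>(copy_edges b n p) \<inter> \<Union>(copy_edges b n q)"
    then have "x \<in> range (glue b n p)" "x \<in> range (glue b n q)"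
      by (auto simp: copy_edges_def)
    then obtain u v where x: "x = glue b n p u" "x = glue b n q v"
      by blast
    then obtain k l where "u = outmost b n k" "v = outmost b n l"
      using glue_eq_glue[OF b pq, of n u v] x by metis
    then have "x = Junction (p + axis k 1)" "x = Junction (q + axis l 1)"
      using x b by (simp_all add: glue_outmost)
    then show "x \<in> junctions p \<inter> junctions q"
      unfolding junctions_def by blast
  qed
  fix p q :: pos
  show "finite (copy_edges b n p)" using SG_wf[OF b] by (simp add: copy_edges_def)
  show "finite (junctions p)" by (simp add: junctions_def UNIV_corner)
  \<comment> \<open>\<open>glue\<close> sends exactly the outmost vertices to
    \<open>Junction\<close> and all others to \<open>Inner\<close>.\<close>
  show "junctions p \<inter> \<Union>(copy_edges b n q) \<subseteq> junctions q"
  proof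
    fix x assume "x \<in> junctions p \<inter> \<Union>(copy_edges b n q)"
    then have "x \<in> range Junction" "x \<in> range (glue b n q)"
      by (auto simp: copy_edges_def junctions_def)
    then obtain y v where "x = Junction y" "x = glue b n q v" by blast
    then show "x \<in> junctions q"
      using b by (cases "v \<in> range (outmost b n)") (auto simp: junctions_def glue_outmost glue_inner)
  qed
  assume "p \<noteq> q"
  then show "\<Union>(copy_edges b n p) \<inter> \<Union>(copy_edges b n q) \<subseteq> junctions p \<inter> junctions q"
    by (rule meet)
  \<comment> \<open>A common edge would have its two endpoints among the common junctions, of which
    there is at most one.\<close>
  show "copy_edges b n p \<inter> copy_edges b n q = {}"
  proof (rule ccontr)
    assume "\<not> ?thesis"
    then obtain e where e: "e \<in> copy_edges b n p" "e \<in> copy_edges b n q" by auto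
    have "inj_on (glue b n p) e'" for e'
      using inj_glue[OF b] by (rule inj_on_subset) simp
    then have "card e = 2"
      using e(1) SG_wf[OF b, of n] by (auto simp: copy_edges_def card_image)
    then obtain x y where "x \<in> e" "y \<in> e" "x \<noteq> y" by (auto simp: card_2_iff)
    then show False
      using card_junctions_meet[OF \<open>p \<noteq> q\<close>, of x y] meet[OF \<open>p \<noteq> q\<close>] e by blast
  qed
qed

lemma card_subset_three:
  assumes "distinct [a, b, c]" "U \<subseteq> {a, b, c}"
  shows "card U = of_bool (a \<in> U) + of_bool (b \<in> U) + of_bool (c \<in> U)"
proof -
  have "U \<in> Pow {a, b, c}" using assms by simp
  then show ?thesis using assms(1) by (auto simp: Pow_insert)
qed

text \<open>Since the weight depends only on the number of covered vertices, the junctions may be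
  listed in any order; the contraction relies on this freedom.\<close>

lemma cover_count_copy:
  assumes b: "b \<ge> 1" and jn: "junctions p = {x, y, z}" "distinct [x, y, z]" and U: "U \<subseteq> junctions p"
    and w: "\<And>U. U \<subseteq> range (outmost b n) \<Longrightarrow>
      cover_count (range (outmost b n)) (edges (SG b n)) U = w (card U)"
  shows "cover_count (junctions p) (copy_edges b n p) U = tri w (x \<in> U) (y \<in> U) (z \<in> U)"
proof -
  obtain U' where U': "U' \<subseteq> range (outmost b n)" "U = glue b n p ` U'"
    using U unfolding junctions_eq_image[OF b, of p n] by (meson subset_imageE)
  have inj: "inj_on (glue b n p) A" for A
    using inj_glue[OF b] by (rule inj_on_subset) simp
  have "cover_count (junctions p) (copy_edges b n p) U = w (card U')"
    using cover_count_image[OF inj U'(1), of "edges (SG b n)"] w[OF U'(1)] b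
    by (simp add: copy_edges_def junctions_eq_image[of b p n] U'(2))
  also have "card U' = card U" by (simp add: U'(2) card_image inj)
  finally show ?thesis using card_subset_three[OF jn(2), of U] U jn(1) by (simp add: tri_def)
qed

lemma cells_4: "cells 4 =
    {(1,1,1), (3,0,0), (2,1,0), (2,0,1), (0,3,0), (1,2,0), (0,2,1), (0,0,3), (1,0,2), (0,1,2)}" (is "_ = ?S")
proof (intro subset_antisym subsetI)
  show "p \<in> ?S"
    if "p \<in> cells 4" for p
  proof -
    obtain i j k where p: "p = (i, j, k)" by (cases p)
    then have *: "i + j + k = 3" using that by (simp add: cells_def)
    then consider "i = 0" | "i = 1" | "i = 2" | "i = 3" by linarith
    then show ?thesis
    proof cases
      case 1
      with * consider "j = 0" "k = 3" | "j = 1" "k = 2" | "j = 2" "k = 1" | "j = 3" "k = 0" by linarith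
      then show ?thesis using 1 p by cases simp_all
    next
      case 2
      with * consider "j = 0" "k = 2" | "j = 1" "k = 1" | "j = 2" "k = 0" by linarith
      then show ?thesis using 2 p by cases simp_all
    next
      case 3
      with * consider "j = 0" "k = 1" | "j = 1" "k = 0" by linarith
      then show ?thesis using 3 p by cases simp_all
    next
      case 4
      with * have "j = 0" "k = 0" by simp_all
      then show ?thesis using 4 p by simp
    qed
  qed
  show "p \<in> cells 4" if "p \<in> ?S" for p
    using that by (auto simp: cells_def)
qed

lemma matchings_intersecting:
  assumes "\<And>e f. e \<in> E \<Longrightarrow> f \<in> E \<Longrightarrow> e \<inter> f \<noteq> {}"
  shows "matchings E = insert {} ((\<lambda>e. {e}) ` E)"
proof (intro subset_antisym subsetI)
  fix M assume M: "M \<in> matchings E"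
  show "M \<in> insert {} ((\<lambda>e. {e}) ` E)"
  proof (cases "M = {}")
    case False
    then obtain e where "e \<in> M" by blast
    moreover have "f = e" if "f \<in> M" for f
    proof -
      have "e \<in> E" "f \<in> E" "f \<noteq> e \<Longrightarrow> f \<inter> e = {}"
        using M that \<open>e \<in> M\<close> by (auto simp: matchings_def disjoint_def)
      then show ?thesis using assms by blast
    qed
    ultimately have "M = {e}" by blast
    then show ?thesis using M \<open>e \<in> M\<close> by (auto simp: matchings_def)
  qed simp
qed (auto simp: matchings_def disjoint_def)

text \<open>Any two edges of a triangle meet, so the matchings are the empty one and the three
  single edges, each covering two vertices.\<close>

lemma cover_count_SG_0:
  assumes U: "U \<subseteq> range (outmost b 0)"
  shows "cover_count (range (outmost b 0)) (edges (SG b 0)) U = (if card U \<in> {0, 2} then 1 else 0)"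
proof -
  define x y z where "x = outmost b 0 C1" and "y = outmost b 0 C2" and "z = outmost b 0 C3"
  have d: "x \<noteq> y" "x \<noteq> z" "y \<noteq> z" "y \<noteq> x" "z \<noteq> x" "z \<noteq> y" by (simp_all add: x_def y_def z_def)
  have r: "range (outmost b 0) = {x, y, z}" by (simp add: UNIV_corner x_def y_def z_def)
  have "edges (SG b 0) = {{x, y}, {x, z}, {y, z}}"
  proof
    show "edges (SG b 0) \<subseteq> {{x, y}, {x, z}, {y, z}}"
    proof
      fix e assume "e \<in> edges (SG b 0)"
      then obtain k l where "e = {outmost b 0 k, outmost b 0 l}" "k \<noteq> l" by auto
      then show "e \<in> {{x, y}, {x, z}, {y, z}}"
        unfolding x_def y_def z_def by (cases k; cases l) (simp_all add: insert_commute)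
    qed
    show "{{x, y}, {x, z}, {y, z}} \<subseteq> edges (SG b 0)"
      unfolding x_def y_def z_def by auto (metis corner.distinct axis.simps)+
  qed
  moreover have "matchings {{x, y}, {x, z}, {y, z}} = {{}, {{x, y}}, {{x, z}}, {{y, z}}}"
    by (subst matchings_intersecting) auto
  ultimately have *: "cover_count (range (outmost b 0)) (edges (SG b 0)) U =
      card {M \<in> {{}, {{x, y}}, {{x, z}}, {{y, z}}}. \<Union>M \<inter> {x, y, z} = U}"
    by (simp only: cover_count_def r)
  have "{M \<in> {{}, {{x, y}}, {{x, z}}, {{y, z}}}. \<Union>M \<inter> {x, y, z} = U} =
     (if U = {} then {{}} else {}) \<union> (if U = {x, y} then {{{x, y}}} else {}) \<union>
     (if U = {x, z} then {{{x, z}}} else {}) \<union> (if U = {y, z} then {{{y, z}}} else {})"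
    by (simp add: Collect_disj_eq conj_disj_distribR Int_insert_left insert_commute eq_commute[of U] cong: conj_cong)
  moreover have "U = {} \<longleftrightarrow> x \<notin> U \<and> y \<notin> U \<and> z \<notin> U" "U = {x, y} \<longleftrightarrow> x \<in> U \<and> y \<in> U \<and> z \<notin> U"
    "U = {x, z} \<longleftrightarrow> x \<in> U \<and> y \<notin> U \<and> z \<in> U" "U = {y, z} \<longleftrightarrow> x \<notin> U \<and> y \<in> U \<and> z \<in> U"
    using U d unfolding r by auto
  moreover have "card U = of_bool (x \<in> U) + of_bool (y \<in> U) + of_bool (z \<in> U)"
    by (rule card_subset_three) (use U d in \<open>simp_all only: r distinct.simps list.set insert_iff empty_iff simp_thms\<close>)
  ultimately show ?thesis
    unfolding * by (cases "x \<in> U"; cases "y \<in> U"; cases "z \<in> U") simp_all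
qed

lemma junctions_cells_4:
  "junctions (1, 1, 1) = {Junction (2, 1, 1), Junction (1, 2, 1), Junction (1, 1, 2)}"
  "junctions (3, 0, 0) = {Junction (4, 0, 0), Junction (3, 1, 0), Junction (3, 0, 1)}"
  "junctions (2, 1, 0) = {Junction (3, 1, 0), Junction (2, 2, 0), Junction (2, 1, 1)}"
  "junctions (2, 0, 1) = {Junction (3, 0, 1), Junction (2, 1, 1), Junction (2, 0, 2)}"
  "junctions (0, 3, 0) = {Junction (1, 3, 0), Junction (0, 4, 0), Junction (0, 3, 1)}"
  "junctions (1, 2, 0) = {Junction (2, 2, 0), Junction (1, 3, 0), Junction (1, 2, 1)}"
  "junctions (0, 2, 1) = {Junction (1, 2, 1), Junction (0, 3, 1), Junction (0, 2, 2)}"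
  "junctions (0, 0, 3) = {Junction (1, 0, 3), Junction (0, 1, 3), Junction (0, 0, 4)}"
  "junctions (1, 0, 2) = {Junction (2, 0, 2), Junction (1, 1, 2), Junction (1, 0, 3)}"
  "junctions (0, 1, 2) = {Junction (1, 1, 2), Junction (0, 2, 2), Junction (0, 1, 3)}"
  by (simp_all add: junctions_eq eval_nat_numeral)

lemma cover_count_SG_Suc:
  assumes w: "\<And>U. U \<subseteq> range (outmost 4 n) \<Longrightarrow>
      cover_count (range (outmost 4 n)) (edges (SG 4 n)) U = w (card U)"
    and U: "U \<subseteq> range (outmost 4 (Suc n))"
  shows "cover_count (range (outmost 4 (Suc n))) (edges (SG 4 (Suc n))) U =
    whole w (outmost 4 (Suc n) C1 \<in> U) (outmost 4 (Suc n) C2 \<in> U) (outmost 4 (Suc n) C3 \<in> U)"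
proof -
  interpret glued_family UNIV junctions "copy_edges 4 n"
    by (rule glued_family_SG) simp
  have cell: "cover_count (junctions p) (copy_edges 4 n p) U = tri w (a \<in> U) (b \<in> U) (c \<in> U)"
    if "p \<in> UNIV" "junctions p = {a, b, c}" "distinct [a, b, c]" "U \<subseteq> junctions p" for p a b c U
    using cover_count_copy[OF _ that(2,3,4) w] by simp
  let ?J = "\<lambda>i j k. Junction (i, j, k)"
  \<comment> \<open>The witnesses \<open>a\<close> and \<open>b\<close> are the two junctions that
    lie strictly inside the block, next to its outmost vertex. Interior positions, such as (2,1,1),
    have no zero coordinate.\<close>
  have b1: "cover_count {?J 4 0 0, ?J 2 1 1, ?J 2 2 0, ?J 2 0 2} (part {(3,0,0), (2,1,0), (2,0,1)}) U =
      block w (?J 4 0 0 \<in> U) (?J 2 1 1 \<in> U) (?J 2 2 0 \<in> U) (?J 2 0 2 \<in> U)"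
    if "U \<subseteq> {?J 4 0 0, ?J 2 1 1, ?J 2 2 0, ?J 2 0 2}" for U
    by (rule cover_count_block[OF cell, where a = "?J 3 1 0" and b = "?J 3 0 1"])
      (use that in \<open>auto simp: junctions_eq\<close>)
  have b2: "cover_count {?J 0 4 0, ?J 1 2 1, ?J 2 2 0, ?J 0 2 2} (part {(0,3,0), (1,2,0), (0,2,1)}) U =
      block w (?J 0 4 0 \<in> U) (?J 1 2 1 \<in> U) (?J 2 2 0 \<in> U) (?J 0 2 2 \<in> U)"
    if "U \<subseteq> {?J 0 4 0, ?J 1 2 1, ?J 2 2 0, ?J 0 2 2}" for U
    by (rule cover_count_block[OF cell, where a = "?J 1 3 0" and b = "?J 0 3 1"])
      (use that in \<open>auto simp: junctions_eq\<close>)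
  have b3: "cover_count {?J 0 0 4, ?J 1 1 2, ?J 2 0 2, ?J 0 2 2} (part {(0,0,3), (1,0,2), (0,1,2)}) U =
      block w (?J 0 0 4 \<in> U) (?J 1 1 2 \<in> U) (?J 2 0 2 \<in> U) (?J 0 2 2 \<in> U)"
    if "U \<subseteq> {?J 0 0 4, ?J 1 1 2, ?J 2 0 2, ?J 0 2 2}" for U
    by (rule cover_count_block[OF cell, where a = "?J 1 0 3" and b = "?J 0 1 3"])
      (use that in \<open>auto simp: junctions_eq\<close>)
  have out: "range (outmost 4 (Suc n)) = {?J 4 0 0, ?J 0 4 0, ?J 0 0 4}"
    by (simp add: UNIV_corner)
  have "cover_count {?J 4 0 0, ?J 0 4 0, ?J 0 0 4}
      (part (insert (1,1,1) ({(3,0,0), (2,1,0), (2,0,1)} \<union> {(0,3,0), (1,2,0), (0,2,1)} \<union> {(0,0,3), (1,0,2), (0,1,2)}))) U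
    = whole w (?J 4 0 0 \<in> U) (?J 0 4 0 \<in> U) (?J 0 0 4 \<in> U)"
    by (rule cover_count_whole[OF cell, where ?i1.0 = "?J 2 1 1" and ?i2.0 = "?J 1 2 1" and ?i3.0 = "?J 1 1 2"
          and ?m12.0 = "?J 2 2 0" and ?m13.0 = "?J 2 0 2" and ?m23.0 = "?J 0 2 2"])
      (simp add: bd_def junctions_cells_4 del: One_nat_def; fail
        | erule b1 | erule b2 | erule b3 | rule U[unfolded out])+
  moreover have "edges (SG 4 (Suc n)) = part (insert (1,1,1)
      ({(3,0,0), (2,1,0), (2,0,1)} \<union> {(0,3,0), (1,2,0), (0,2,1)} \<union> {(0,0,3), (1,0,2), (0,1,2)}))"
    by (simp add: part_def cells_4 copy_edges_def Un_ac)
  ultimately show ?thesis by (simp only: out outmost.simps axis.simps)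
qed

text \<open>The thresholds pick the first k corners as representatives. From stage 1 on, arguments
  above 3 repeat the value at 3, and so does \<open>direction\<close>; hence inequalities demanded
  for all k reduce to four cases.\<close>

primrec corner_weight :: "nat \<Rightarrow> nat \<Rightarrow> nat" where
  "corner_weight 0 k = (if k \<in> {0, 2} then 1 else 0)"
| "corner_weight (Suc n) k = whole (corner_weight n) (1 \<le> k) (2 \<le> k) (3 \<le> k)"

lemma cover_count_SG:
  "U \<subseteq> range (outmost 4 n) \<Longrightarrow>
     cover_count (range (outmost 4 n)) (edges (SG 4 n)) U = corner_weight n (card U)"
proof (induction n arbitrary: U)
  case 0
  then show ?case by (simp only: cover_count_SG_0 corner_weight.simps)
next
  case (Suc n)
  let ?x = "outmost 4 (Suc n)"
  have "cover_count (range ?x) (edges (SG 4 (Suc n))) U =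
      whole (corner_weight n) (?x C1 \<in> U) (?x C2 \<in> U) (?x C3 \<in> U)"
    by (rule cover_count_SG_Suc[OF Suc.IH Suc.prems])
  also have "\<dots> = corner_weight (Suc n) (of_bool (?x C1 \<in> U) + of_bool (?x C2 \<in> U) + of_bool (?x C3 \<in> U))"
    by (subst whole_count) (simp only: Let_def corner_weight.simps)
  also have "of_bool (?x C1 \<in> U) + of_bool (?x C2 \<in> U) + of_bool (?x C3 \<in> U) = card U"
  proof (rule card_subset_three[symmetric])
    show "U \<subseteq> {?x C1, ?x C2, ?x C3}" using Suc.prems unfolding UNIV_corner by (simp only: image_insert image_empty)
  qed simp
  finally show ?case .
qed

text \<open>The configurations impose their condition only at vertices in \<open>verts\<close>; as
  all edges lie inside \<open>verts\<close>, this is plain disjointness.\<close>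

lemma N_DM_SG: "b \<ge> 1 \<Longrightarrow> N_DM (SG b n) = card (matchings (edges (SG b n)))"
proof -
  assume b: "b \<ge> 1"
  have "(\<forall>v\<in>verts (SG b n). \<forall>e\<in>M. \<forall>f\<in>M. v \<in> e \<longrightarrow> v \<in> f \<longrightarrow> e = f) \<longleftrightarrow> disjoint M"
    if "M \<subseteq> edges (SG b n)" for M
  proof -
    have "\<Union>M \<subseteq> verts (SG b n)" using SG_wf[OF b, of n] that by blast
    then have "(\<forall>v\<in>verts (SG b n). \<forall>e\<in>M. \<forall>f\<in>M. v \<in> e \<longrightarrow> v \<in> f \<longrightarrow> e = f) \<longleftrightarrow>
        (\<forall>e\<in>M. \<forall>f\<in>M. \<forall>v. v \<in> e \<longrightarrow> v \<in> f \<longrightarrow> e = f)"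
      by auto
    then show ?thesis unfolding disjoint_def by blast
  qed
  then have "dimer_monomer_configs (SG b n) = matchings (edges (SG b n))"
    unfolding dimer_monomer_configs_def matchings_def by auto
  then show ?thesis by (simp add: N_DM_def)
qed

lemma N_DM_corner_weight:
  "N_DM (SG 4 n) = corner_weight n 0 + 3 * corner_weight n 1 + 3 * corner_weight n 2 + corner_weight n 3"
proof -
  let ?M = "matchings (edges (SG 4 n))" and ?J = "range (outmost 4 n)"
  obtain x y z where J: "?J = {x, y, z}" "x \<noteq> y" "x \<noteq> z" "y \<noteq> z"
    using that[of "outmost 4 n C1" "outmost 4 n C2" "outmost 4 n C3"]
    by (simp add: UNIV_corner outmost_eq_iff)
  have fin: "finite ?M" using SG_wf[of 4 n] by (simp add: finite_matchings)
  have finJ: "finite ?J" by (simp add: UNIV_corner)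
  have "N_DM (SG 4 n) = (\<Sum>M\<in>?M. 1)" by (simp add: N_DM_SG)
  also have "\<dots> = (\<Sum>U\<in>Pow ?J. \<Sum>M\<in>{M \<in> ?M. \<Union>M \<inter> ?J = U}. 1)"
    by (rule sum.group[symmetric]) (use fin finJ in auto)
  also have "\<dots> = (\<Sum>U\<in>Pow ?J. corner_weight n (card U))"
    by (rule sum.cong) (simp_all add: cover_count_SG flip: cover_count_def)
  also have "\<dots> = corner_weight n 0 + 3 * corner_weight n 1 + 3 * corner_weight n 2 + corner_weight n 3"
    unfolding J(1) using J(2-) by (simp add: sum_Pow_insert card_insert_if eval_nat_numeral)
  finally show ?thesis .
qed

lemma card_cells_4: "card (cells 4) = 10"
  by (simp add: cells_4)

lemma N_DM_SG_Suc_le: "N_DM (SG 4 (Suc n)) \<le> N_DM (SG 4 n) ^ 10"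
proof -
  have inj: "inj_on (glue 4 n p) A" for p A
    using inj_glue[of 4 n p] by (auto intro: inj_on_subset)
  have card: "card (matchings (copy_edges 4 n p)) = card (matchings (edges (SG 4 n)))" for p
    \<comment> \<open>With no visible vertices, \<open>cover_count\<close> counts all
      matchings.\<close>
    using cover_count_image[where f = "glue 4 n p" and E = "edges (SG 4 n)" and J = "{}" and U = "{}", OF inj]
    by (simp add: cover_count_def copy_edges_def)
  have "N_DM (SG 4 (Suc n)) = card (matchings (\<Union>p\<in>cells 4. copy_edges 4 n p))"
    by (subst N_DM_SG) (simp_all add: copy_edges_def)
  also have "\<dots> \<le> (\<Prod>p\<in>cells 4. card (matchings (copy_edges 4 n p)))"
    by (rule card_matchings_Union_le) (use SG_wf[of 4 n] in \<open>simp_all add: copy_edges_def cells_4\<close>)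
  also have "\<dots> = N_DM (SG 4 n) ^ 10"
    by (simp add: card N_DM_SG card_cells_4)
  finally show ?thesis .
qed

text \<open>There are 15 positions with coordinate sum 4, and each of the ten copies adds its
  vertices other than the three outmost ones: 15 + 10 (v - 3) = 10 v - 15.\<close>

lemma num_verts_SG_Suc: "num_verts (SG 4 (Suc n)) + 15 = 10 * num_verts (SG 4 n)"
proof -
  let ?V = "verts (SG 4 n)" and ?O = "range (outmost 4 n)"
  have wf: "finite ?V" "?O \<subseteq> ?V" using SG_wf[of 4 n] by auto
  have O: "card ?O = 3" "finite ?O" by (simp_all add: UNIV_corner card_insert_if outmost_eq_iff)
  have copy: "glue 4 n p ` ?V = junctions p \<union> Inner p ` (?V - ?O)" for p
  proof -
    have "glue 4 n p ` ?V = glue 4 n p ` ?O \<union> glue 4 n p ` (?V - ?O)" using wf by blast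
    moreover have "glue 4 n p ` (?V - ?O) = Inner p ` (?V - ?O)"
      by (rule image_cong) (simp_all add: glue_inner)
    ultimately show ?thesis by (simp add: junctions_eq_image[of 4 p n])
  qed
  let ?I = "\<Union>p\<in>cells 4. Inner p ` (?V - ?O)"
  have V: "verts (SG 4 (Suc n)) = (\<Union>p\<in>cells 4. junctions p) \<union> ?I"
    unfolding SG.simps graph.simps copy by blast
  have junctions: "card (\<Union>p\<in>cells 4. junctions p) = 15" "finite (\<Union>p\<in>cells 4. junctions p)"
    by (simp_all add: cells_4 junctions_cells_4 card_insert_if del: One_nat_def)
  have "card ?I = (\<Sum>p\<in>cells 4. card (Inner p ` (?V - ?O)))"
    by (rule card_UN_disjoint) (use wf in \<open>auto simp: cells_4\<close>)
  also have "\<dots> = 10 * (card ?V - 3)"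
    using wf O by (simp add: card_image inj_on_def card_Diff_subset card_cells_4)
  finally have I: "card ?I = 10 * (card ?V - 3)" .
  have "card ?V \<ge> 3" using card_mono[OF wf] O by simp
  moreover have "card (verts (SG 4 (Suc n))) = 15 + card ?I"
    unfolding V junctions(1)[symmetric]
    by (rule card_Un_disjoint) (use wf junctions in \<open>auto simp: cells_4 junctions_def\<close>)
  ultimately show ?thesis by (simp only: num_verts_def I)
qed

lemma num_verts_SG: "3 * num_verts (SG 4 n) = 4 * 10 ^ n + 5"
proof (induction n)
  case 0
  show ?case by (simp add: num_verts_def UNIV_corner card_insert_if)
next
  case (Suc n)
  then show ?case using num_verts_SG_Suc[of n] by simp
qed

section \<open>Bounds from an approximately invariant direction\<close>

lemma share_mono:
  fixes f g :: "bool \<Rightarrow> bool \<Rightarrow> real"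
  shows "(\<And>a b. f a b \<le> g a b) \<Longrightarrow> share f \<le> share g"
  by (simp add: share_def add_mono)

lemma share_nonneg:
  fixes f :: "bool \<Rightarrow> bool \<Rightarrow> real"
  shows "(\<And>a b. 0 \<le> f a b) \<Longrightarrow> 0 \<le> share f"
  by (simp add: share_def)

lemma joint_mono:
  fixes f g :: "bool \<Rightarrow> bool \<Rightarrow> real"
  shows "(\<And>a b. f a b \<le> g a b) \<Longrightarrow> joint i f \<le> joint i g"
  by (simp add: joint_def add_mono)

lemma joint_nonneg:
  fixes f :: "bool \<Rightarrow> bool \<Rightarrow> real"
  shows "(\<And>a b. 0 \<le> f a b) \<Longrightarrow> 0 \<le> joint i f"
  by (simp add: joint_def)

lemma block_nonneg:
  fixes v :: "nat \<Rightarrow> real"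
  assumes "\<And>k. 0 \<le> v k"
  shows "0 \<le> block v x i m n"
  unfolding block_def tri_def by (intro share_nonneg joint_nonneg mult_nonneg_nonneg assms)

lemma block_mono:
  fixes v w :: "nat \<Rightarrow> real"
  assumes "\<And>k. 0 \<le> v k" "\<And>k. v k \<le> w k"
  shows "block v x i m n \<le> block w x i m n"
proof -
  have "0 \<le> w k" for k using assms order_trans by blast
  then show ?thesis
    unfolding block_def tri_def
    by (intro share_mono joint_mono mult_mono share_nonneg mult_nonneg_nonneg assms)
qed

lemma whole_mono:
  fixes v w :: "nat \<Rightarrow> real"
  assumes "\<And>k. 0 \<le> v k" "\<And>k. v k \<le> w k"
  shows "whole v x1 x2 x3 \<le> whole w x1 x2 x3"
proof -
  have w: "0 \<le> w k" for k using assms order_trans by blast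
  have "tri v a b c \<le> tri w a b c" "0 \<le> tri v a b c" "0 \<le> tri w a b c" for a b c
    by (simp_all add: tri_def assms w)
  then show ?thesis
    unfolding whole_flat
    by (intro share_mono mult_mono mult_nonneg_nonneg block_mono block_nonneg assms w)
qed

lemma block_scale:
  "block (\<lambda>k. s * v k) x i m n = s ^ 3 * block v x i m n"
proof -
  have "block (\<lambda>k. s * v k) x i m n = share (\<lambda>b b'. joint i (\<lambda>y z.
     share (\<lambda>a a'. s ^ 3 * (tri v x a b * tri v a' y m * tri v b' z n))))"
    unfolding block_def share_mult by (simp add: tri_def power3_eq_cube mult_ac)
  also have "\<dots> = s ^ 3 * block v x i m n"
    unfolding block_def share_mult by (simp add: share_def joint_def algebra_simps)
  finally show ?thesis .
qed

text \<open>The degree is the number of copies: one from the centre and three from each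
  block.\<close>

lemma whole_scale:
  "whole (\<lambda>k. s * v k) x1 x2 x3 = s ^ 10 * whole v x1 x2 x3"
proof -
  have *: "tri (\<lambda>k. s * v k) c1 c2 c3 * b1 * b2 * b3 = s * (tri v c1 c2 c3 * b1 * b2 * b3)"
    for c1 c2 c3 b1 b2 b3 by (simp add: tri_def mult_ac)
  have **: "s * (t * (s ^ 3 * b1) * (s ^ 3 * b2) * (s ^ 3 * b3)) = s ^ 10 * (t * b1 * b2 * b3)"
    for t b1 b2 b3 by (simp add: eval_nat_numeral mult_ac)
  show ?thesis
    unfolding whole_flat share_mult(2) * block_scale ** ..
qed

lemma of_nat_share: "of_nat (share f) = share (\<lambda>a b. of_nat (f a b))"
  by (simp add: share_def)

lemma of_nat_joint: "of_nat (joint i f) = joint i (\<lambda>a b. of_nat (f a b))"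
  by (simp add: joint_def)

lemma of_nat_whole: "of_nat (whole w x1 x2 x3) = whole (\<lambda>k. of_nat (w k)) x1 x2 x3"
  unfolding whole_def block_def tri_def
  by (simp only: of_nat_share of_nat_joint of_nat_mult)

primrec growth :: "real \<Rightarrow> real \<Rightarrow> nat \<Rightarrow> real" where
  "growth lam s 0 = s"
| "growth lam s (Suc j) = lam * growth lam s j ^ 10"

lemma scale_pos: "0 < lam \<Longrightarrow> 0 < s \<Longrightarrow> 0 < growth lam s j"
  by (induction j) auto

text \<open>The logarithm follows the map x to 10 x + \<open>ln lam\<close>, whose fixed point is
  -\<open>ln lam\<close> / 9; the distance to it is multiplied by 10 in each step.\<close>

lemma ln_scale:
  assumes "0 < lam" "0 < s"
  shows "ln (growth lam s j) = 10 ^ j * (ln s + ln lam / 9) - ln lam / 9"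
proof (induction j)
  case (Suc j)
  have "ln (growth lam s (Suc j)) = ln lam + 10 * ln (growth lam s j)"
    using scale_pos[OF assms, of j] assms by (simp add: ln_mult ln_realpow)
  then show ?case using Suc by (simp add: field_simps)
qed simp

text \<open>A Collatz-Wielandt argument for a nonlinear map: in the induction step homogeneity
  extracts the tenth power of the scale, \<open>eig\<close> supplies \<open>lam\<close>, and
  monotonicity passes to the true weights.\<close>

lemma corner_weight_lower:
  fixes v :: "nat \<Rightarrow> real"
  assumes "\<And>k. 0 \<le> v k" "0 < lam" "0 < s" and base: "\<And>k. s * v k \<le> corner_weight m k"
    and eig: "\<And>k. lam * v k \<le> whole v (1 \<le> k) (2 \<le> k) (3 \<le> k)"
  shows "growth lam s j * v k \<le> corner_weight (m + j) k"
proof (induction j arbitrary: k)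
  case 0
  show ?case using base by simp
next
  case (Suc j)
  let ?S = "growth lam s j"
  have S: "0 < ?S" using scale_pos assms by simp
  have "growth lam s (Suc j) * v k = ?S ^ 10 * (lam * v k)" by simp
  also have "\<dots> \<le> ?S ^ 10 * whole v (1 \<le> k) (2 \<le> k) (3 \<le> k)"
    using eig S by (intro mult_left_mono) auto
  also have "\<dots> = whole (\<lambda>k. ?S * v k) (1 \<le> k) (2 \<le> k) (3 \<le> k)" by (simp only: whole_scale)
  also have "\<dots> \<le> whole (\<lambda>k. real (corner_weight (m + j) k)) (1 \<le> k) (2 \<le> k) (3 \<le> k)"
    using Suc assms S by (intro whole_mono) auto
  also have "\<dots> = corner_weight (m + Suc j) k" by (simp add: of_nat_whole)
  finally show ?case .
qed

lemma corner_weight_upper: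
  fixes v :: "nat \<Rightarrow> real"
  assumes "\<And>k. 0 \<le> v k" "0 < lam" "0 < s" and base: "\<And>k. corner_weight m k \<le> s * v k"
    and eig: "\<And>k. whole v (1 \<le> k) (2 \<le> k) (3 \<le> k) \<le> lam * v k"
  shows "corner_weight (m + j) k \<le> growth lam s j * v k"
proof (induction j arbitrary: k)
  case 0
  show ?case using base by simp
next
  case (Suc j)
  let ?S = "growth lam s j"
  have S: "0 < ?S" using scale_pos assms by simp
  have "real (corner_weight (m + Suc j) k) = whole (\<lambda>k. real (corner_weight (m + j) k)) (1 \<le> k) (2 \<le> k) (3 \<le> k)"
    by (simp add: of_nat_whole)
  also have "\<dots> \<le> whole (\<lambda>k. ?S * v k) (1 \<le> k) (2 \<le> k) (3 \<le> k)"
    using Suc by (intro whole_mono) auto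
  also have "\<dots> = ?S ^ 10 * whole v (1 \<le> k) (2 \<le> k) (3 \<le> k)" by (simp only: whole_scale)
  also have "\<dots> \<le> ?S ^ 10 * (lam * v k)"
    using eig S by (intro mult_left_mono) auto
  also have "\<dots> = growth lam s (Suc j) * v k" by simp
  finally show ?case .
qed

lemma N_DM_pos: "0 < N_DM (SG 4 n)"
proof -
  have "{} \<in> matchings (edges (SG 4 n))" by (simp add: matchings_def disjoint_def)
  moreover have "finite (matchings (edges (SG 4 n)))" using SG_wf[of 4 n] by (simp add: finite_matchings)
  ultimately show ?thesis by (auto simp: N_DM_SG card_gt_0_iff)
qed

lemma convergent_ln_N_DM: "convergent (\<lambda>n. ln (N_DM (SG 4 n)) / 10 ^ n)"
proof -
  have dec: "decseq (\<lambda>n. ln (real (N_DM (SG 4 n))) / 10 ^ n)"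
  proof (rule decseq_SucI)
    fix n
    have "real (N_DM (SG 4 (Suc n))) \<le> real (N_DM (SG 4 n)) ^ 10"
      using N_DM_SG_Suc_le[of n] by (metis of_nat_le_iff of_nat_power)
    then have "ln (real (N_DM (SG 4 (Suc n)))) \<le> ln (real (N_DM (SG 4 n)) ^ 10)"
      using N_DM_pos[of n] N_DM_pos[of "Suc n"] by (subst ln_le_cancel_iff) auto
    also have "\<dots> = 10 * ln (real (N_DM (SG 4 n)))"
      using N_DM_pos[of n] by (simp add: ln_realpow)
    finally show "ln (real (N_DM (SG 4 (Suc n)))) / 10 ^ Suc n \<le> ln (real (N_DM (SG 4 n))) / 10 ^ n"
      by (simp add: field_simps)
  qed
  \<comment> \<open>The empty matching makes the count at least 1, which bounds the decreasing
    sequence from below.\<close>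
  have "0 \<le> ln (real (N_DM (SG 4 n))) / 10 ^ n" for n
    using N_DM_pos[of n] by simp
  then show ?thesis
    using decseq_convergent[OF dec, of 0] unfolding convergent_def by metis
qed

text \<open>Only the exponential rate survives: a constant factor contributes a logarithm that
  vanishes after division by 10^(m + j). Below, the matchings avoiding all outmost vertices are
  enough; above, all four weights enter.\<close>

lemma ln_N_DM_lim_bounds:
  fixes v :: "nat \<Rightarrow> real"
  assumes lim: "(\<lambda>n. ln (N_DM (SG 4 n)) / 10 ^ n) \<longlonglongrightarrow> L"
    and v: "\<And>k. 0 \<le> v k" "v 0 > 0"
  shows ln_N_DM_lim_lower: "0 < lam \<Longrightarrow> 0 < s \<Longrightarrow> (\<And>k. s * v k \<le> corner_weight m k) \<Longrightarrow>
      (\<And>k. lam * v k \<le> whole v (1 \<le> k) (2 \<le> k) (3 \<le> k)) \<Longrightarrow>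
      (ln s + ln lam / 9) / 10 ^ m \<le> L"
    and ln_N_DM_lim_upper: "0 < lam \<Longrightarrow> 0 < s \<Longrightarrow> (\<And>k. corner_weight m k \<le> s * v k) \<Longrightarrow>
      (\<And>k. whole v (1 \<le> k) (2 \<le> k) (3 \<le> k) \<le> lam * v k) \<Longrightarrow>
      L \<le> (ln s + ln lam / 9) / 10 ^ m"
proof -
  have sub: "(\<lambda>j. ln (N_DM (SG 4 (m + j))) / 10 ^ (m + j)) \<longlonglongrightarrow> L"
    using LIMSEQ_ignore_initial_segment[OF lim, of m] by (simp add: add.commute)
  have scale_lim: "(\<lambda>j. (ln (growth lam s j * c)) / 10 ^ (m + j)) \<longlonglongrightarrow> (ln s + ln lam / 9) / 10 ^ m"
    if "0 < lam" "0 < s" "0 < c" for lam s c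
  proof -
    have eq: "(ln (growth lam s j * c)) / 10 ^ (m + j) =
        (ln s + ln lam / 9) / 10 ^ m + (ln c - ln lam / 9) / 10 ^ m * (1 / 10) ^ j" for j
    proof -
      have "ln (growth lam s j * c) = 10 ^ j * (ln s + ln lam / 9) - ln lam / 9 + ln c"
        using ln_mult_pos[OF scale_pos[OF that(1,2)] that(3)] ln_scale[OF that(1,2)] by simp
      then show ?thesis by (simp only:) (simp add: power_add field_simps)
    qed
    have "(\<lambda>j. (ln s + ln lam / 9) / 10 ^ m + (ln c - ln lam / 9) / 10 ^ m * (1 / 10) ^ j)
        \<longlonglongrightarrow> (ln s + ln lam / 9) / 10 ^ m + (ln c - ln lam / 9) / 10 ^ m * 0"
      by (intro tendsto_intros LIMSEQ_realpow_zero) auto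
    then show ?thesis unfolding eq by simp
  qed
  have N: "real (N_DM (SG 4 n)) = corner_weight n 0 + 3 * real (corner_weight n 1) +
      3 * real (corner_weight n 2) + corner_weight n 3" for n
    by (simp add: N_DM_corner_weight)
  {
    assume A: "0 < lam" "0 < s" "\<And>k. s * v k \<le> corner_weight m k"
      "\<And>k. lam * v k \<le> whole v (1 \<le> k) (2 \<le> k) (3 \<le> k)"
    have "ln (growth lam s j * v 0) / 10 ^ (m + j) \<le> ln (N_DM (SG 4 (m + j))) / 10 ^ (m + j)" for j
    proof -
      have "growth lam s j * v 0 \<le> N_DM (SG 4 (m + j))"
        using corner_weight_lower[OF v(1) A, of j 0] unfolding N by linarith
      moreover have "0 < growth lam s j * v 0" using scale_pos[OF A(1,2)] v(2) by simp
      ultimately show ?thesis by (simp add: divide_right_mono)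
    qed
    then show "(ln s + ln lam / 9) / 10 ^ m \<le> L"
      using LIMSEQ_le[OF scale_lim[OF A(1,2) v(2)] sub] by blast
  }
  {
    assume A: "0 < lam" "0 < s" "\<And>k. corner_weight m k \<le> s * v k"
      "\<And>k. whole v (1 \<le> k) (2 \<le> k) (3 \<le> k) \<le> lam * v k"
    \<comment> \<open>The coefficients are the numbers of sets of 0, 1, 2 and 3 outmost
      vertices.\<close>
    define c where "c = v 0 + 3 * v 1 + 3 * v 2 + v 3"
    have c: "0 < c" using v(1)[of 1] v(1)[of 2] v(1)[of 3] v(2) by (simp add: c_def)
    have "ln (N_DM (SG 4 (m + j))) / 10 ^ (m + j) \<le> ln (growth lam s j * c) / 10 ^ (m + j)" for j
    proof -
      have "growth lam s j * c = growth lam s j * v 0 + 3 * (growth lam s j * v 1) +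
          3 * (growth lam s j * v 2) + growth lam s j * v 3"
        by (simp add: c_def algebra_simps)
      then have "N_DM (SG 4 (m + j)) \<le> growth lam s j * c"
        using corner_weight_upper[OF v(1) A, of j 0] corner_weight_upper[OF v(1) A, of j 1]
          corner_weight_upper[OF v(1) A, of j 2] corner_weight_upper[OF v(1) A, of j 3]
        unfolding N by linarith
      moreover have "0 < real (N_DM (SG 4 (m + j)))" using N_DM_pos by simp
      ultimately show ?thesis by (simp add: divide_right_mono)
    qed
    then show "L \<le> (ln s + ln lam / 9) / 10 ^ m"
      using LIMSEQ_le[OF sub scale_lim[OF A(1,2) c]] by blast
  }
qed

text \<open>The series of 2 artanh t. It has positive terms, so partial sums are lower bounds, and
  its tail is dominated by a geometric series.\<close>

lemma ln_artanh_bounds: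
  fixes t :: real
  assumes "0 < t" "t \<le> 1 / 3"
  shows "(\<Sum>k<n. 2 * t ^ (2 * k + 1) / real (2 * k + 1)) \<le> ln ((1 + t) / (1 - t))"
    and "ln ((1 + t) / (1 - t)) \<le>
      (\<Sum>k<n. 2 * t ^ (2 * k + 1) / real (2 * k + 1)) + 3 / real (2 * n + 1) * t ^ (2 * n + 1)"
proof -
  have x: "((1 + t) / (1 - t) - 1) / ((1 + t) / (1 - t) + 1) = t" "1 < (1 + t) / (1 - t)"
    using assms by (simp_all add: field_simps)
  show "(\<Sum>k<n. 2 * t ^ (2 * k + 1) / real (2 * k + 1)) \<le> ln ((1 + t) / (1 - t))"
    using ln_approx_bounds[OF x(2), of n] by (simp add: x(1))
  have "t * t \<le> 1 / 3 * (1 / 3)" using assms by (intro mult_mono) auto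
  \<comment> \<open>Weaker than the available 8/9, but it turns the factor 2 of the remainder into
    3, which cancels against 2 n + 1 for n = 1.\<close>
  then have t2: "2 / 3 \<le> 1 - t\<^sup>2" by (simp add: power2_eq_square)
  have "2 * (t ^ (2 * n + 1) / (1 - t\<^sup>2) / real (2 * n + 1)) \<le> 2 * (t ^ (2 * n + 1) / (2 / 3) / real (2 * n + 1))"
    using t2 assms by (intro mult_left_mono divide_right_mono divide_left_mono) auto
  also have "\<dots> = 3 / real (2 * n + 1) * t ^ (2 * n + 1)" by (simp add: field_simps)
  finally show "ln ((1 + t) / (1 - t)) \<le>
      (\<Sum>k<n. 2 * t ^ (2 * k + 1) / real (2 * k + 1)) + 3 / real (2 * n + 1) * t ^ (2 * n + 1)"
    using ln_approx_bounds[OF x(2), of n] by (simp add: x(1))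
qed

lemma ln_N_DM_per_vertex_lim:
  assumes "(\<lambda>n. ln (N_DM (SG 4 n)) / 10 ^ n) \<longlonglongrightarrow> L"
  shows "(\<lambda>n. ln (real (N_DM (SG 4 n))) / real (num_verts (SG 4 n))) \<longlonglongrightarrow> 3 / 4 * L"
proof -
  have eq: "ln (real (N_DM (SG 4 n))) / real (num_verts (SG 4 n)) =
      3 * (ln (N_DM (SG 4 n)) / 10 ^ n) / (4 + 5 * (1 / 10) ^ n)" for n
  proof -
    have "3 * real (num_verts (SG 4 n)) = 4 * 10 ^ n + 5"
      using arg_cong[OF num_verts_SG[of n], of real] by simp
    then have V: "real (num_verts (SG 4 n)) = (4 * 10 ^ n + 5) / 3" by simp
    have "(0::real) < 4 * 10 ^ n + 5" by (simp add: add_pos_pos)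
    then show ?thesis unfolding V by (simp add: field_simps)
  qed
  have "(\<lambda>n. 3 * (ln (N_DM (SG 4 n)) / 10 ^ n) / (4 + 5 * (1 / 10) ^ n)) \<longlonglongrightarrow> 3 * L / (4 + 5 * 0)"
    by (intro tendsto_intros assms LIMSEQ_realpow_zero) auto
  then show ?thesis unfolding eq by simp
qed

section \<open>Numerical evaluation\<close>

text \<open>The corner blocks form a ring through the three side junctions; this is the ring with
  the states towards the centre held fixed.\<close>

definition ring_sum :: "(bool \<Rightarrow> bool \<Rightarrow> 'a::comm_semiring_1) \<Rightarrow> (bool \<Rightarrow> bool \<Rightarrow> 'a) \<Rightarrow> (bool \<Rightarrow> bool \<Rightarrow> 'a) \<Rightarrow> 'a" where
  "ring_sum A B C = share (\<lambda>m m'. share (\<lambda>n n'. share (\<lambda>k k'. A m n * B m' k * C n' k')))"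

lemma ring_sum_add:
  "ring_sum (\<lambda>m n. A m n + A' m n) B C = ring_sum A B C + ring_sum A' B C"
  "ring_sum A (\<lambda>m n. B m n + B' m n) C = ring_sum A B C + ring_sum A B' C"
  "ring_sum A B (\<lambda>m n. C m n + C' m n) = ring_sum A B C + ring_sum A B C'"
  by (simp_all add: ring_sum_def share_def algebra_simps)

lemma whole_eq_ring_sum: "whole w x1 x2 x3 =
  share (\<lambda>c1 i1. share (\<lambda>c2 i2. share (\<lambda>c3 i3.
    tri w c1 c2 c3 * ring_sum (block w x1 i1) (block w x2 i2) (block w x3 i3))))"
  unfolding whole_flat ring_sum_def share_mult(2) by (simp only: mult.assoc)

text \<open>The block at a corner after contracting its interior junction with the centre copy; the first
  index has moreover been contracted with the neighbouring block.\<close>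
definition contracted_block :: "(nat \<Rightarrow> 'a::comm_semiring_1) \<Rightarrow> bool \<Rightarrow> bool \<Rightarrow> bool \<Rightarrow> bool \<Rightarrow> 'a" where
  "contracted_block w x c m n =
     (let B = (\<lambda>m n. block w x False m n + (if c then 0 else block w x True m n))
      in if m then B False n else B False n + B True n)"

text \<open>The trace of the 2 x 2 matrix product A C B, factored for evaluation.\<close>

definition trace3 :: "(bool \<Rightarrow> bool \<Rightarrow> 'a::comm_semiring_1) \<Rightarrow> (bool \<Rightarrow> bool \<Rightarrow> 'a) \<Rightarrow> (bool \<Rightarrow> bool \<Rightarrow> 'a) \<Rightarrow> 'a" where
  "trace3 A B C =
     (A False False * B False False + A True False * B False True) * C False False +
     (A False False * B True False + A True False * B True True) * C False True +
     (A False True * B False False + A True True * B False True) * C True False +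
     (A False True * B True False + A True True * B True True) * C True True"

lemma trace3_contracted:
  fixes A B C :: "bool \<Rightarrow> bool \<Rightarrow> 'a::comm_semiring_1"
  assumes "B True False = B False True"
  shows "trace3 (\<lambda>m n. if m then A False n else A False n + A True n)
      (\<lambda>m n. if m then B False n else B False n + B True n)
      (\<lambda>m n. if m then C False n else C False n + C True n) = ring_sum A B C"
  by (simp add: ring_sum_def share_def trace3_def assms algebra_simps)

lemma trace3_contracted_block:
  "trace3 (contracted_block w x1 c1) (contracted_block w x2 c2) (contracted_block w x3 c3) =
   ring_sum (\<lambda>m n. block w x1 False m n + (if c1 then 0 else block w x1 True m n))
     (\<lambda>m n. block w x2 False m n + (if c2 then 0 else block w x2 True m n))
     (\<lambda>m n. block w x3 False m n + (if c3 then 0 else block w x3 True m n))"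
proof -
  have "contracted_block w x c = (\<lambda>m n. if m then (\<lambda>m n. block w x False m n + (if c then 0 else block w x True m n)) False n
     else (\<lambda>m n. block w x False m n + (if c then 0 else block w x True m n)) False n +
       (\<lambda>m n. block w x False m n + (if c then 0 else block w x True m n)) True n)" for x c
    by (simp add: fun_eq_iff contracted_block_def)
  then show ?thesis
    by (simp only:) (rule trace3_contracted, simp add: block_swap[of w x2 _ True])
qed

text \<open>For a fixed state of the centre at a junction, the block there is uncovered or, if the
  centre leaves the junction free, also covered. As the ring is linear in each block, these
  alternatives are added inside the block, and 27 ring sums become 8 traces.\<close>

lemma whole_eq_trace3:
  "whole w x1 x2 x3 = (\<Sum>c1\<in>UNIV. \<Sum>c2\<in>UNIV. \<Sum>c3\<in>UNIV. tri w c1 c2 c3 *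
     trace3 (contracted_block w x1 c1) (contracted_block w x2 c2) (contracted_block w x3 c3))"
proof -
  define R where "R i1 i2 i3 = ring_sum (block w x1 i1) (block w x2 i2) (block w x3 i3)" for i1 i2 i3
  have "trace3 (contracted_block w x1 c1) (contracted_block w x2 c2) (contracted_block w x3 c3) =
    (\<Sum>i1\<in>(if c1 then {False} else {False, True}). \<Sum>i2\<in>(if c2 then {False} else {False, True}). \<Sum>i3\<in>(if c3 then {False} else {False, True}). R i1 i2 i3)" for c1 c2 c3
    unfolding trace3_contracted_block
    by (cases c1; cases c2; cases c3) (simp_all add: ring_sum_add R_def UNIV_bool add_ac)
  then show ?thesis
    unfolding whole_eq_ring_sum R_def[symmetric]
    by (simp add: share_def UNIV_bool algebra_simps)
qed

text \<open>The weights of stage 2 divided by the first one, scaled by 10^12 so that the evaluation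
  takes place in the natural numbers. The entries are nearly powers of 0.858766468942.\<close>

definition direction :: "nat \<Rightarrow> nat" where
  "direction k = (if k = 0 then 1000000000000 else if k = 1 then 858766468942
     else if k = 2 then 737479848179 else 633322965136)"

text \<open>Stating this for a function known only by four values makes them the sole rewrite rules;
  blocks and contracted blocks are evaluated once each and reused in all four results.\<close>

lemma whole_weights_0:
  fixes w :: "nat \<Rightarrow> nat"
  assumes w: "w 0 = 1" "w 1 = 0" "w 2 = 1" "w 3 = 0"
  shows "whole w False False False = 2220"
    "whole w True False False = 1914"
    "whole w True True False = 1640"
    "whole w True True True = 1396"
proof -
  \<comment> \<open>The sums of \<open>of_bool\<close> in \<open>tri\<close> may reach the
    simplifier's normal form with \<open>Suc\<close> instead of numerals.\<close>
  have w': "w (Suc 0) = 0" "w (Suc (Suc 0)) = 1" "w (Suc (Suc (Suc 0))) = 0"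
    using w by (simp_all add: numeral_2_eq_2 numeral_3_eq_3)
  have b: "block w False False False False = 2"
    "block w False False False True = 1"
    "block w False False True False = 1"
    "block w False False True True = 1"
    "block w False True False False = 2"
    "block w False True False True = 3"
    "block w False True True False = 3"
    "block w False True True True = 2"
    "block w True False False False = 2"
    "block w True False False True = 1"
    "block w True False True False = 1"
    "block w True False True True = 0"
    "block w True True False False = 2"
    "block w True True False True = 2"
    "block w True True True False = 2"
    "block w True True True True = 2"
    by (simp_all add: block_def share_def joint_def tri_def w w')
  have o: "contracted_block w False False False False = 8"
    "contracted_block w False False False True = 7"
    "contracted_block w False False True False = 4"
    "contracted_block w False False True True = 4"
    "contracted_block w False True False False = 3"
    "contracted_block w False True False True = 2"
    "contracted_block w False True True False = 2"
    "contracted_block w False True True True = 1"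
    "contracted_block w True False False False = 7"
    "contracted_block w True False False True = 5"
    "contracted_block w True False True False = 4"
    "contracted_block w True False True True = 3"
    "contracted_block w True True False False = 3"
    "contracted_block w True True False True = 1"
    "contracted_block w True True True False = 2"
    "contracted_block w True True True True = 1"
    by (simp_all add: contracted_block_def b)
  show "whole w False False False = 2220"
    "whole w True False False = 1914"
    "whole w True True False = 1640"
    "whole w True True True = 1396"
    by (simp_all add: whole_eq_trace3 UNIV_bool trace3_def tri_def o w w')
qed

lemma whole_weights_1:
  fixes w :: "nat \<Rightarrow> nat"
  assumes w: "w 0 = 2220" "w 1 = 1914" "w 2 = 1640" "w 3 = 1396"
  shows "whole w False False False = 1095249688634151454219516689432826798080"
    "whole w True False False = 940563707718765231855988194853818067968"
    "whole w True True False = 807724574091886425362687789454449995776"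
    "whole w True True True = 693646780368841817581399832196591292416"
proof -
  have w': "w (Suc 0) = 1914" "w (Suc (Suc 0)) = 1640" "w (Suc (Suc (Suc 0))) = 1396"
    using w by (simp_all add: numeral_2_eq_2 numeral_3_eq_3)
  have b: "block w False False False False = 81153671760"
    "block w False False False True = 69830964504"
    "block w False False True False = 69830964504"
    "block w False False True True = 60088021728"
    "block w False True False False = 139661929008"
    "block w False True False True = 119798430528"
    "block w False True True False = 119798430528"
    "block w False True True True = 102759008352"
    "block w True False False False = 69692356584"
    "block w True False False True = 59968519224"
    "block w True False True False = 59968519224"
    "block w True False True True = 51601401720"
    "block w True True False False = 119937038448"
    "block w True True False True = 102878510856"
    "block w True True True False = 102878510856"
    "block w True True True True = 88245323872"
    by (simp_all add: block_def share_def joint_def tri_def w w')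
  have o: "contracted_block w False False False False = 410444995800"
    "contracted_block w False False False True = 352476425112"
    "contracted_block w False False True False = 220815600768"
    "contracted_block w False False True True = 189629395032"
    "contracted_block w False True False False = 150984636264"
    "contracted_block w False True False True = 129918986232"
    "contracted_block w False True True False = 81153671760"
    "contracted_block w False True True True = 69830964504"
    "contracted_block w True False False False = 352476425112"
    "contracted_block w True False False True = 302693755672"
    "contracted_block w True False True False = 189629395032"
    "contracted_block w True False True True = 162847030080"
    "contracted_block w True True False False = 129660875808"
    "contracted_block w True True False True = 111569920944"
    "contracted_block w True True True False = 69692356584"
    "contracted_block w True True True True = 59968519224"
    by (simp_all add: contracted_block_def b)
  show "whole w False False False = 1095249688634151454219516689432826798080"
    "whole w True False False = 940563707718765231855988194853818067968"
    "whole w True True False = 807724574091886425362687789454449995776"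
    "whole w True True True = 693646780368841817581399832196591292416"
    by (simp_all add: whole_eq_trace3 UNIV_bool trace3_def tri_def o w w')
qed

lemma whole_direction_weights:
  fixes w :: "nat \<Rightarrow> nat"
  assumes w: "w 0 = 1000000000000" "w 1 = 858766468942" "w 2 = 737479848179" "w 3 = 633322965136"
  shows "whole w False False False = 369721717586134450685284788006370103159994300125166301979439431439011234360067334064399983021117037596242258366133530465141760"
    "whole w True False False = 317504613902567217933360006197113469722743475335267228751338227122450984721790208583052175968575546451506327270337980238102528"
    "whole w True True False = 272662316153858777481671093080082602248748493194158476555439249174956319473010251823346552491253286932419951868512922582350336"
    "whole w True True True = 234153254456960553793823721986662641724462581226439646050737863692854937742363756320927555613383634314728600409156896324199808"
proof -
  have w': "w (Suc 0) = 858766468942" "w (Suc (Suc 0)) = 737479848179" "w (Suc (Suc (Suc 0))) = 633322965136"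
    using w by (simp_all add: numeral_2_eq_2 numeral_3_eq_3)
  have b: "block w False False False False = 7384985268484333151798092000000000000"
    "block w False False False True = 6341977722204676833355653714990952888"
    "block w False False True False = 6341977722204676833355653714990952888"
    "block w False False True True = 5446277814606279349889656879003780244"
    "block w False True False False = 12683955444409353666711307429981905776"
    "block w False True False True = 10892555629210729448582976028677738400"
    "block w False True True False = 10892555629210729448582976028677738400"
    "block w False True True True = 9354161535449587140651214410573374120"
    "block w True False False False = 6341977722204003703999671714990952888"
    "block w True False False True = 5446277814605701288969479014338869200"
    "block w True False True False = 5446277814605701288969479014338869200"
    "block w True False True True = 4677080767725868050581039503357054882"
    "block w True True False False = 10892555629211402577938958028677738400"
    "block w True True False True = 9354161535450165201571392275238285164"
    "block w True True True False = 9354161535450165201571392275238285164"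
    "block w True True True True = 8033040271709884037622754954314154018"
    by (simp_all add: block_def share_def joint_def tri_def w w')
  have o: "contracted_block w False False False False = 37303474064309093100448029173650597064"
    "contracted_block w False False False True = 32034972701471272772479501033245845652"
    "contracted_block w False False True False = 20068940712893686818509399429981905776"
    "contracted_block w False False True True = 17234533351415406281938629743668691288"
    "contracted_block w False True False False = 13726962990689009985153745714990952888"
    "contracted_block w False True False True = 11788255536810956183245310593994733132"
    "contracted_block w False True True False = 7384985268484333151798092000000000000"
    "contracted_block w False True True True = 6341977722204676833355653714990952888"
    "contracted_block w True False False False = 32034972701471272772479501033245845652"
    "contracted_block w True False False True = 27510560389491618578744665747248363264"
    "contracted_block w True False True False = 17234533351415406281938629743668691288"
    "contracted_block w True False True True = 14800439350055866490540871289577154364"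
    "contracted_block w True True False False = 11788255536809704992969150729329822088"
    "contracted_block w True True False True = 10123358582331569339550518517695924082"
    "contracted_block w True True True False = 6341977722204003703999671714990952888"
    "contracted_block w True True True True = 5446277814605701288969479014338869200"
    by (simp_all add: contracted_block_def b)
  show "whole w False False False = 369721717586134450685284788006370103159994300125166301979439431439011234360067334064399983021117037596242258366133530465141760"
    "whole w True False False = 317504613902567217933360006197113469722743475335267228751338227122450984721790208583052175968575546451506327270337980238102528"
    "whole w True True False = 272662316153858777481671093080082602248748493194158476555439249174956319473010251823346552491253286932419951868512922582350336"
    "whole w True True True = 234153254456960553793823721986662641724462581226439646050737863692854937742363756320927555613383634314728600409156896324199808"
    by (simp_all add: whole_eq_trace3 UNIV_bool trace3_def tri_def o w w')
qed

lemma corner_weight_1: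
  "corner_weight 1 0 = 2220" "corner_weight 1 1 = 1914"
  "corner_weight 1 2 = 1640" "corner_weight 1 3 = 1396"
  using whole_weights_0[of "corner_weight 0"] by simp_all

lemma corner_weight_2:
  "corner_weight 2 0 = 1095249688634151454219516689432826798080" "corner_weight 2 1 = 940563707718765231855988194853818067968"
  "corner_weight 2 2 = 807724574091886425362687789454449995776" "corner_weight 2 3 = 693646780368841817581399832196591292416"
proof -
  have "corner_weight 2 k = whole (corner_weight 1) (1 \<le> k) (2 \<le> k) (3 \<le> k)" for k
    by (simp only: numeral_2_eq_2 One_nat_def corner_weight.simps)
  then show "corner_weight 2 0 = 1095249688634151454219516689432826798080" "corner_weight 2 1 = 940563707718765231855988194853818067968"
    "corner_weight 2 2 = 807724574091886425362687789454449995776" "corner_weight 2 3 = 693646780368841817581399832196591292416"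
    using whole_weights_1[OF corner_weight_1] by (simp_all del: One_nat_def)
qed

lemma corner_weight_ge_3: "0 < n \<Longrightarrow> 3 \<le> k \<Longrightarrow> corner_weight n k = corner_weight n 3"
  by (cases n) simp_all

lemma nat_le_2_cases:
  fixes k :: nat
  obtains "k = 0" | "k = 1" | "k = 2" | "3 \<le> k"
  by linarith

lemma whole_direction:
  fixes k :: nat
  shows
  "whole direction (1 \<le> k) (2 \<le> k) (3 \<le> k) =
    (if k = 0 then 369721717586134450685284788006370103159994300125166301979439431439011234360067334064399983021117037596242258366133530465141760
     else if k = 1 then 317504613902567217933360006197113469722743475335267228751338227122450984721790208583052175968575546451506327270337980238102528
     else if k = 2 then 272662316153858777481671093080082602248748493194158476555439249174956319473010251823346552491253286932419951868512922582350336
     else 234153254456960553793823721986662641724462581226439646050737863692854937742363756320927555613383634314728600409156896324199808)"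
  using whole_direction_weights[of direction]
  by (cases k rule: nat_le_2_cases) (simp_all add: direction_def)

section \<open>Enclosures of the logarithms of 2, 23/13 and 227/189\<close>

lemma ln_2_bounds: "0.69314718055994 \<le> ln (2 :: real)" "ln (2 :: real) \<le> 0.69314718055995"
proof -
  \<comment> \<open>\<open>ln 2\<close> enters the final estimate with coefficient 1178, hence more
    digits than for the other two logarithms.\<close>
  have "0.69314718055994 \<le> (\<Sum>k<14. 2 * (1 / 3) ^ (2 * k + 1) / real (2 * k + 1))"
    by (simp add: lessThan_nat_numeral lessThan_Suc power_divide)
  also have "\<dots> \<le> ln ((1 + 1 / 3) / (1 - 1 / 3))"
    by (rule ln_artanh_bounds) simp_all
  finally show "0.69314718055994 \<le> ln (2 :: real)" by simp
  have "ln ((1 + 1 / 3) / (1 - 1 / 3) :: real) \<le>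
      (\<Sum>k<14. 2 * (1 / 3) ^ (2 * k + 1) / real (2 * k + 1)) + 3 / real (2 * 14 + 1) * (1 / 3) ^ (2 * 14 + 1)"
    by (rule ln_artanh_bounds) simp_all
  also have "\<dots> \<le> 0.69314718055995"
    by (simp add: lessThan_nat_numeral lessThan_Suc power_divide)
  finally show "ln (2 :: real) \<le> 0.69314718055995" by simp
qed

lemma ln_23_13_bounds: "0.57054485846 \<le> ln (23 / 13 :: real)" "ln (23 / 13 :: real) \<le> 0.57054485848"
proof -
  \<comment> \<open>For a fraction a/b the argument of the series is (a - b) / (a + b), here
    10/36.\<close>
  have "0.57054485846 \<le> (\<Sum>k<10. 2 * (5 / 18) ^ (2 * k + 1) / real (2 * k + 1))"
    by (simp add: lessThan_nat_numeral lessThan_Suc power_divide)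
  also have "\<dots> \<le> ln ((1 + 5 / 18) / (1 - 5 / 18))"
    by (rule ln_artanh_bounds) simp_all
  finally show "0.57054485846 \<le> ln (23 / 13 :: real)" by simp
  have "ln ((1 + 5 / 18) / (1 - 5 / 18) :: real) \<le>
      (\<Sum>k<10. 2 * (5 / 18) ^ (2 * k + 1) / real (2 * k + 1)) + 3 / real (2 * 10 + 1) * (5 / 18) ^ (2 * 10 + 1)"
    by (rule ln_artanh_bounds) simp_all
  also have "\<dots> \<le> 0.57054485848"
    by (simp add: lessThan_nat_numeral lessThan_Suc power_divide)
  finally show "ln (23 / 13 :: real) \<le> 0.57054485848" by simp
qed

lemma ln_227_189_bounds: "0.18320300242 \<le> ln (227 / 189 :: real)" "ln (227 / 189 :: real) \<le> 0.18320300243"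
proof -
  have "0.18320300242 \<le> (\<Sum>k<6. 2 * (19 / 208) ^ (2 * k + 1) / real (2 * k + 1))"
    by (simp add: lessThan_nat_numeral lessThan_Suc power_divide)
  also have "\<dots> \<le> ln ((1 + 19 / 208) / (1 - 19 / 208))"
    by (rule ln_artanh_bounds) simp_all
  finally show "0.18320300242 \<le> ln (227 / 189 :: real)" by simp
  have "ln ((1 + 19 / 208) / (1 - 19 / 208) :: real) \<le>
      (\<Sum>k<6. 2 * (19 / 208) ^ (2 * k + 1) / real (2 * k + 1)) + 3 / real (2 * 6 + 1) * (19 / 208) ^ (2 * 6 + 1)"
    by (rule ln_artanh_bounds) simp_all
  also have "\<dots> \<le> 0.18320300243"
    by (simp add: lessThan_nat_numeral lessThan_Suc power_divide)
  finally show "ln (227 / 189 :: real) \<le> 0.18320300243" by simp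
qed

lemma ln_artanh_small_bounds:
  fixes t :: real
  assumes "0 < t" "t \<le> 1 / 3"
  shows "2 * t \<le> ln ((1 + t) / (1 - t))" "ln ((1 + t) / (1 - t)) \<le> 2 * t + t ^ 3"
proof -
  have "(\<Sum>k<1. 2 * t ^ (2 * k + 1) / real (2 * k + 1)) = 2 * t"
    by (simp add: lessThan_Suc)
  moreover have "3 / real (2 * 1 + 1) * t ^ (2 * 1 + 1) = t ^ 3" by (simp del: power_Suc)
  ultimately show "2 * t \<le> ln ((1 + t) / (1 - t))" "ln ((1 + t) / (1 - t)) \<le> 2 * t + t ^ 3"
    using ln_artanh_bounds[OF assms, of 1] by (simp_all only:)
qed

theorem mainTheorem4:
  "\<exists>z::real.
     (\<lambda>n. ln (real (N_DM (SG 4 n))) / real (num_verts (SG 4 n))) \<longlonglongrightarrow> z \<and>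
     0.684872262332 \<le> z \<and> z < 0.684872262333"
proof -
  obtain L where L: "(\<lambda>n. ln (N_DM (SG 4 n)) / 10 ^ n) \<longlonglongrightarrow> L"
    using convergent_ln_N_DM unfolding convergent_def by blast
  have pos: "direction 0 > 0"
    by (simp_all add: direction_def)
  \<comment> \<open>\<open>2 ^ 89 * y1\<close> and \<open>2 ^ 89 * y2\<close> approximate the factor between the direction and the weights of
    stage 2, \<open>2 ^ 377 * u1\<close> and \<open>2 ^ 377 * u2\<close> its eigenvalue. The fractions 23/13 and 227/189
    keep the argument of \<open>q\<close> tiny, so that few series terms with small denominators suffice.\<close>
  define q :: "real \<Rightarrow> real" where "q t = (1 + t) / (1 - t)" for t
  define y1 y2 u1 u2 where "y1 = 23 / 13 * q 0.0000679729794" and "y2 = 23 / 13 * q 0.0000679729807"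
    and "u1 = 227 / 189 * q 0.0000029284219" and "u2 = 227 / 189 * q 0.0000029284223"
  note defs = q_def y1_def y2_def u1_def u2_def
  have lower: "(ln (2 ^ 89 * y1) + ln (2 ^ 377 * u1) / 9) / 10 ^ 2 \<le> L"
  proof (rule ln_N_DM_lim_lower[OF L, where v = "\<lambda>k. real (direction k)"])
    show "2 ^ 89 * y1 * direction k \<le> corner_weight 2 k" for k
      by (cases k rule: nat_le_2_cases) (simp_all add: defs direction_def corner_weight_2[unfolded One_nat_def] corner_weight_ge_3)
    show "2 ^ 377 * u1 * direction k \<le> whole (\<lambda>k. real (direction k)) (1 \<le> k) (2 \<le> k) (3 \<le> k)" for k
      unfolding of_nat_whole[symmetric] whole_direction
      by (cases k rule: nat_le_2_cases) (simp_all add: defs direction_def)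
  qed (simp_all add: pos defs)
  have upper: "L \<le> (ln (2 ^ 89 * y2) + ln (2 ^ 377 * u2) / 9) / 10 ^ 2"
  proof (rule ln_N_DM_lim_upper[OF L, where v = "\<lambda>k. real (direction k)"])
    show "corner_weight 2 k \<le> 2 ^ 89 * y2 * direction k" for k
      by (cases k rule: nat_le_2_cases) (simp_all add: defs direction_def corner_weight_2[unfolded One_nat_def] corner_weight_ge_3)
    show "whole (\<lambda>k. real (direction k)) (1 \<le> k) (2 \<le> k) (3 \<le> k) \<le> 2 ^ 377 * u2 * direction k" for k
      unfolding of_nat_whole[symmetric] whole_direction
      by (cases k rule: nat_le_2_cases) (simp_all add: defs direction_def)
  qed (simp_all add: pos defs)
  have ln_pow: "ln (2 ^ m * y) = m * ln 2 + ln y" if "0 < y" for m and y :: real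
    using that by (simp add: ln_mult ln_realpow)
  have y_pos: "0 < y1" "0 < y2" "0 < u1" "0 < u2"
    by (simp_all add: defs)
  have ln_q: "ln (c * q t) = ln c + ln (q t)" if "0 < c" "0 < t" "t \<le> 1 / 3" for c t
    using that by (intro ln_mult_pos) (auto simp: q_def)
  have "ln y1 \<ge> 0.57054485846 + 2 * 0.0000679729794"
    using ln_artanh_small_bounds(1)[of "0.0000679729794"] ln_23_13_bounds(1)
    unfolding y1_def by (subst ln_q) (simp_all add: q_def)
  moreover have "ln y2 \<le> 0.57054485848 + (2 * 0.0000679729807 + 0.0000679729807 ^ 3)"
    using ln_artanh_small_bounds(2)[of "0.0000679729807"] ln_23_13_bounds(2)
    unfolding y2_def by (subst ln_q) (simp_all add: q_def)
  moreover have "ln u1 \<ge> 0.18320300242 + 2 * 0.0000029284219"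
    using ln_artanh_small_bounds(1)[of "0.0000029284219"] ln_227_189_bounds(1)
    unfolding u1_def by (subst ln_q) (simp_all add: q_def)
  moreover have "ln u2 \<le> 0.18320300243 + (2 * 0.0000029284223 + 0.0000029284223 ^ 3)"
    using ln_artanh_small_bounds(2)[of "0.0000029284223"] ln_227_189_bounds(2)
    unfolding u2_def by (subst ln_q) (simp_all add: q_def)
  \<comment> \<open>The enclosure multiplied by 900 = 9 * 10^2; the powers of two collect to 9 * 89
    + 377 = 1178.\<close>
  moreover have "1178 * ln 2 + 9 * ln y1 + ln u1 \<le> 900 * L"
    using lower unfolding ln_pow[OF y_pos(1)] ln_pow[OF y_pos(3)] by (simp add: field_simps)
  moreover have "900 * L \<le> 1178 * ln 2 + 9 * ln y2 + ln u2"
    using upper unfolding ln_pow[OF y_pos(2)] ln_pow[OF y_pos(4)] by (simp add: field_simps)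
  \<comment> \<open>The bounds for 900 L are about 2.3e-10 apart, mostly from the enclosure of ln
    (23/13); for 3/4 L this means about 2e-13, within the required window of width 1e-12.\<close>
  ultimately have "0.684872262332 \<le> 3 / 4 * L" "3 / 4 * L < 0.684872262333"
    using ln_2_bounds by (simp_all add: power_divide)
  then show ?thesis using ln_N_DM_per_vertex_lim[OF L] by blast
qed

end
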